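(* If $\lambda\in\mathcal{R}$, then there are no purely balanced or exceptional directions at $\lambda$. If $\lambda\in G\setminus\mathcal{R}$, then there are exactly two exceptional directions at $\lambda$, and the purely balanced directions at $\lambda$ form a simple smooth curve in $\mathbb{CP}^1$ connecting the two exceptional directions.
   Context: $\mathbb{D}$ is the open unit disc and $\mathbb{T}$ the unit circle in $\mathbb{C}$. $G=\{(z+w,zw): |z|<1,|w|<1\}\subset\mathbb{C}^2$ is the symmetrized bidisc. The royal variety is $\mathcal{R}=\{(2z,z^2):z\in\mathbb{D}\}$, and $\partial\mathcal{R}=\{(2z,z^2):z\in\mathbb{T}\}$. A geodesic (that is, complex geodesic) in $G$ is a set $D=h(\mathbb{D})$ where $h:\mathbb{D}\to G$ is holomorphic and has a holomorphic left inverse $\Phi:G\to\mathbb{D}$, $\Phi\circ h=\mathrm{id}_{\mathbb{D}}$. If $\lambda=h(z)\in D$, the complex tangent space is $T_\lambda D=\mathbb{C}\,h'(z)\subset\mathbb{C}^2$. A geodesic $D$ is purely balanced if $D^-\cap\mathcal{R}^-$ (closures in $\mathbb{C}^2$) consists of exactly two points, both in $\partial\mathcal{R}$; $D$ is exceptional if $D^-\cap\mathcal{R}^-$ consists of exactly one point, and that point lies in $\partial\mathcal{R}$. Elements of $\mathbb{CP}^1$, regarded as one-dimensional complex subspaces of $\mathbb{C}^2$, are called directions. It is known that for every $\lambda\in G$ and every direction $\mathcal{M}$ there is a unique geodesic $D$ with $\lambda\in D$ and $T_\lambda D=\mathcal{M}$; the direction $\mathcal{M}$ is called purely balanced (respectively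 exceptional) at $\lambda$ if this $D$ is purely balanced (respectively exceptional). "The purely balanced directions form a simple smooth curve connecting the exceptional directions" means: there is an injective smooth curve $c:[a,b]\to\mathbb{CP}^1$ such that $c(a),c(b)$ are the two exceptional directions at $\lambda$ and $c((a,b))$ is the set of purely balanced directions at $\lambda$. *)

theory Defs
  imports "HOL-Analysis.Analysis"
begin

section \<open>The symmetrized bidisc and the royal variety\<close>

definition symmetrized_bidisc :: "(complex^2) set" where
  "symmetrized_bidisc = {vector [z + w, z * w] | z w. norm z < 1 \<and> norm w < 1}"

definition royal_variety :: "(complex^2) set" where
  "royal_variety = {vector [2 * z, z\<^sup>2] | z. norm z < 1}"

text \<open>Customarily written \<open>\<partial>\<R>\<close>; this is not the topological frontier in \<open>\<complex>\<^sup>2\<close>.\<close>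

definition royal_boundary :: "(complex^2) set" where
  "royal_boundary = {vector [2 * z, z\<^sup>2] | z. norm z = 1}"

section \<open>Complex geodesics\<close>

text \<open>A function of two complex variables is holomorphic on an open set if it is Frechet
  differentiable there with complex-linear derivative.\<close>

definition holomorphic_C2 :: "(complex^2 \<Rightarrow> complex) \<Rightarrow> (complex^2) set \<Rightarrow> bool" where
  "holomorphic_C2 \<Phi> S \<longleftrightarrow>
    (\<forall>x\<in>S. \<exists>L. Vector_Spaces.linear (*s) (*) L \<and> (\<Phi> has_derivative L) (at x))"

definition geodesic_map :: "(complex \<Rightarrow> complex^2) \<Rightarrow> bool" where
  "geodesic_map h \<longleftrightarrow>
    (\<forall>i. (\<lambda>z. h z $ i) holomorphic_on ball 0 1) \<and> h ` ball 0 1 \<subseteq> symmetrized_bidisc \<and>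
    (\<exists>\<Phi>. holomorphic_C2 \<Phi> symmetrized_bidisc \<and> \<Phi> ` symmetrized_bidisc \<subseteq> ball 0 1 \<and>
         (\<forall>z\<in>ball 0 1. \<Phi> (h z) = z))"

definition geodesic :: "(complex^2) set \<Rightarrow> bool" where
  "geodesic D \<longleftrightarrow> (\<exists>h. geodesic_map h \<and> D = h ` ball 0 1)"

definition deriv_C2 :: "(complex \<Rightarrow> complex^2) \<Rightarrow> complex \<Rightarrow> complex^2" where
  "deriv_C2 h z = (\<chi> i. deriv (\<lambda>w. h w $ i) z)"

text \<open>The line \<open>\<complex> h'(z)\<close> at \<open>h z = x\<close> does not depend on the geodesic map \<open>h\<close> parametrizing \<open>D\<close>:
  two such maps differ by an automorphism of the disc.  Hence the union over all
  parametrizations is that line.\<close>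

definition tangent_space :: "(complex^2) set \<Rightarrow> complex^2 \<Rightarrow> (complex^2) set" where
  "tangent_space D x =
    {c *s deriv_C2 h z | c h z. geodesic_map h \<and> D = h ` ball 0 1 \<and> z \<in> ball 0 1 \<and> h z = x}"

definition purely_balanced :: "(complex^2) set \<Rightarrow> bool" where
  "purely_balanced D \<longleftrightarrow> geodesic D \<and>
    card (closure D \<inter> closure royal_variety) = 2 \<and>
    closure D \<inter> closure royal_variety \<subseteq> royal_boundary"

definition exceptional :: "(complex^2) set \<Rightarrow> bool" where
  "exceptional D \<longleftrightarrow> geodesic D \<and>
    card (closure D \<inter> closure royal_variety) = 1 \<and>
    closure D \<inter> closure royal_variety \<subseteq> royal_boundary"

section \<open>Directions and smooth curves in the projective line\<close>

definition CP1 :: "(complex^2) set set" where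
  "CP1 = {M. vec.subspace M \<and> vec.dim M = 1}"

text \<open>For each \<open>x\<close> in the symmetrized bidisc and each direction \<open>M\<close>, there is exactly one
  geodesic through \<open>x\<close> with tangent space \<open>M\<close>; so the \<open>D\<close> asked for below is that geodesic.\<close>

definition purely_balanced_direction :: "complex^2 \<Rightarrow> (complex^2) set \<Rightarrow> bool" where
  "purely_balanced_direction x M \<longleftrightarrow> M \<in> CP1 \<and>
    (\<exists>D. geodesic D \<and> x \<in> D \<and> tangent_space D x = M \<and> purely_balanced D)"

definition exceptional_direction :: "complex^2 \<Rightarrow> (complex^2) set \<Rightarrow> bool" where
  "exceptional_direction x M \<longleftrightarrow> M \<in> CP1 \<and>
    (\<exists>D. geodesic D \<and> x \<in> D \<and> tangent_space D x = M \<and> exceptional D)"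

text \<open>The two standard affine charts of \<open>CP1\<close>: for distinct indices \<open>i\<close> and \<open>j\<close>, the line spanned
  by a vector \<open>v\<close> with \<open>v $ i \<noteq> 0\<close> has coordinate \<open>v $ j / v $ i\<close>.\<close>

definition chart_domain :: "2 \<Rightarrow> (complex^2) set set" where
  "chart_domain i = {M \<in> CP1. \<exists>v\<in>M. v $ i \<noteq> 0}"

definition chart :: "2 \<Rightarrow> 2 \<Rightarrow> (complex^2) set \<Rightarrow> complex" where
  "chart i j M = (THE u. \<exists>v\<in>M. v $ i \<noteq> 0 \<and> u = v $ j / v $ i)"

text \<open>Infinitely differentiable, with one-sided derivatives at endpoints belonging to \<open>S\<close>;
  intended for \<open>S\<close> without isolated points.\<close>

definition C_infinity_on :: "real set \<Rightarrow> (real \<Rightarrow> complex) \<Rightarrow> bool" where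
  "C_infinity_on S f \<longleftrightarrow>
    (\<exists>F. F 0 = f \<and>
         (\<forall>n. \<forall>t\<in>S. (F n has_vector_derivative F (Suc n) t) (at t within S)))"

text \<open>Smooth curves are taken to be regular, i.e. the velocity never vanishes, so that an
  injective one has an embedded smooth arc as its image, without corners or cusps.\<close>

definition smooth_curve_CP1 :: "real \<Rightarrow> real \<Rightarrow> (real \<Rightarrow> (complex^2) set) \<Rightarrow> bool" where
  "smooth_curve_CP1 a b c \<longleftrightarrow>
    (\<forall>t\<in>{a..b}. \<exists>U i j. open U \<and> t \<in> U \<and> i \<noteq> j \<and>
       c ` (U \<inter> {a..b}) \<subseteq> chart_domain i \<and>
       C_infinity_on (U \<inter> {a..b}) (chart i j \<circ> c) \<and>
       vector_derivative (chart i j \<circ> c) (at t within {a..b}) \<noteq> 0)"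

end

theory Submission
  imports Defs "HOL-Complex_Analysis.Riemann_Mapping"
begin

text \<open>Write \<open>sym_pair z w = (z + w, z w)\<close>.  A point of the royal variety in the symmetrized bidisc lies in
  the intersection of closures for each geodesic through it but not in the royal boundary, which settles
  the first claim.

  Let \<open>x = sym_pair z w\<close> with \<open>z \<noteq> w\<close>.  The geodesics in question avoid the royal variety, so they
  lift to pairs of self-maps of the disc that agree nowhere.  A left inverse, pulled back to the bidisc,
  satisfies the Schwarz-Pick inequality \<open>bidisc_schwarz_pick\<close>.  This makes one component an automorphism,
  which can be normalized to the identity, and by the symmetry of the pullback it makes the other one an
  automorphism as well (\<open>left_inverse_rigidity\<close>).  Hence the geodesic is the set of the \<open>sym_pair t (m t)\<close>
  for an automorphism \<open>m\<close> of the disc without fixed points in the disc and with \<open>m z = w\<close>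
  (\<open>geodesic_avoiding_royal\<close>).  Its closure meets the closure of the royal variety in the fixed points of
  \<open>m\<close> on the circle: it is exceptional if \<open>m\<close> is parabolic and purely balanced if \<open>m\<close> is hyperbolic.

  Conversely, let \<open>m\<close> fix a boundary point.  In a half-plane coordinate with this point at infinity, \<open>m\<close>
  is affine, and the mean of the coordinates of the two entries of a pair provides a left inverse
  (\<open>boundary_fixed_point_geodesic\<close>).

  The automorphisms with \<open>m z = w\<close> form a circle, parametrized by the derivative at \<open>z\<close>.  The tangent
  direction of the geodesic is spanned by \<open>(1, w) + m'(z) (1, z)\<close>, so it depends on \<open>m'(z)\<close> through an
  affine coordinate of the projective line.  The trace of the matrix of \<open>m\<close> is proportional to the
  cosine of half the angle along this circle, measured from a suitable origin.  Therefore the hyperbolic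
  automorphisms fill an open arc, and the parabolic ones are its two end points
  (\<open>direction_arc\<close>).\<close>

section \<open>Automorphisms of the disc and the Schwarz-Pick lemma\<close>

text \<open>For \<open>norm b < norm a\<close> these are the automorphisms of the disc, as fractional linear maps whose
  matrix is a positive multiple of an element of \<open>SU(1,1)\<close>.  The matrix is not normalized to determinant 1, so that all coefficients stay
  polynomial; a common real factor of \<open>a\<close> and \<open>b\<close> does not change the map.\<close>

definition disc_aut :: "complex \<Rightarrow> complex \<Rightarrow> complex \<Rightarrow> complex" where
  "disc_aut a b z = (a * z + b) / (cnj b * z + cnj a)"

lemma disc_aut_denom_nonzero:
  assumes "norm b < norm a" "norm z \<le> 1"
  shows "cnj b * z + cnj a \<noteq> 0"
proof
  assume "cnj b * z + cnj a = 0"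
  then have "norm a = norm (cnj b * z)"
    by (metis add_eq_0_iff complex_mod_cnj norm_minus_cancel)
  also have "\<dots> \<le> norm b * 1"
    unfolding norm_mult using assms(2) by (intro mult_mono) auto
  finally show False
    using assms(1) by simp
qed

lemma disc_aut_norm_identity:
  "(norm (cnj b * z + cnj a))\<^sup>2 - (norm (a * z + b))\<^sup>2
     = ((norm a)\<^sup>2 - (norm b)\<^sup>2) * (1 - (norm z)\<^sup>2)"
proof -
  have "complex_of_real ((norm (cnj b * z + cnj a))\<^sup>2 - (norm (a * z + b))\<^sup>2)
     = complex_of_real (((norm a)\<^sup>2 - (norm b)\<^sup>2) * (1 - (norm z)\<^sup>2))"
    unfolding of_real_diff of_real_mult of_real_1 complex_norm_square
    by (simp add: algebra_simps)
  then show ?thesis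
    by (simp only: of_real_eq_iff)
qed

lemma disc_aut_norm_less_1:
  assumes "norm b < norm a" "norm z < 1"
  shows "norm (disc_aut a b z) < 1"
proof -
  have "(norm b)\<^sup>2 < (norm a)\<^sup>2" "(norm z)\<^sup>2 < 1"
    using assms by (auto intro: power_strict_mono simp: power_less_one_iff abs_square_less_1)
  then have "(norm (a * z + b))\<^sup>2 < (norm (cnj b * z + cnj a))\<^sup>2"
    using disc_aut_norm_identity[of b z a] by (smt (verit) mult_pos_pos)
  then have "norm (a * z + b) < norm (cnj b * z + cnj a)"
    using power2_less_imp_less norm_ge_zero by blast
  then show ?thesis
    by (simp add: disc_aut_def norm_divide divide_less_eq)
qed

text \<open>The adjugate matrix has coefficients \<open>cnj a\<close> and \<open>- b\<close>, so the inverse is again a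
  \<open>disc_aut\<close>.\<close>

lemma disc_aut_inverse:
  assumes "norm b < norm a" "norm z \<le> 1"
  shows "disc_aut (cnj a) (- b) (disc_aut a b z) = z"
proof -
  have nz: "cnj b * z + cnj a \<noteq> 0"
    by (rule disc_aut_denom_nonzero[OF assms])
  have "a * cnj a - b * cnj b \<noteq> 0"
  proof -
    have "a * cnj a - b * cnj b = of_real ((norm a)\<^sup>2 - (norm b)\<^sup>2)"
      by (simp only: of_real_diff complex_norm_square)
    moreover have "(norm b)\<^sup>2 < (norm a)\<^sup>2"
      using assms by (auto intro: power_strict_mono)
    ultimately show ?thesis
      by (metis diff_gt_0_iff_gt less_irrefl of_real_eq_0_iff)
  qed
  moreover have "cnj a * disc_aut a b z - b = (a * cnj a - b * cnj b) * z / (cnj b * z + cnj a)"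
    using nz by (simp add: disc_aut_def field_simps)
  moreover have "- cnj b * disc_aut a b z + a = (a * cnj a - b * cnj b) / (cnj b * z + cnj a)"
    using nz by (simp add: disc_aut_def field_simps)
  ultimately show ?thesis
    using nz unfolding disc_aut_def[of "cnj a"] by simp
qed

lemma disc_aut_inverse':
  assumes "norm b < norm a" "norm z \<le> 1"
  shows "disc_aut a b (disc_aut (cnj a) (- b) z) = z"
  using disc_aut_inverse[of "- b" "cnj a" z] assms by simp

lemma disc_aut_has_field_derivative:
  assumes "norm b < norm a" "norm z \<le> 1"
  shows "(disc_aut a b has_field_derivative
           ((norm a)\<^sup>2 - (norm b)\<^sup>2) / (cnj b * z + cnj a)\<^sup>2) (at z)"
  unfolding disc_aut_def of_real_diff complex_norm_square
  using disc_aut_denom_nonzero[OF assms]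
  by (auto intro!: derivative_eq_intros simp: algebra_simps power2_eq_square)

lemma disc_aut_holomorphic:
  assumes "norm b < norm a"
  shows "disc_aut a b holomorphic_on ball 0 1"
  by (rule holomorphic_onI)
     (use disc_aut_has_field_derivative[OF assms] in
       \<open>auto simp: field_differentiable_def intro: has_field_derivative_at_within less_imp_le\<close>)

lemma disc_aut_image_ball:
  assumes "norm b < norm a"
  shows "disc_aut a b ` ball 0 1 = ball 0 1"
proof
  show "disc_aut a b ` ball 0 1 \<subseteq> ball 0 1"
    using disc_aut_norm_less_1[OF assms] by auto
  show "ball 0 1 \<subseteq> disc_aut a b ` ball 0 1"
  proof
    fix z :: complex assume "z \<in> ball 0 1"
    then have "disc_aut a b (disc_aut (cnj a) (- b) z) = z" "disc_aut (cnj a) (- b) z \<in> ball 0 1"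
      using disc_aut_inverse'[OF assms] disc_aut_norm_less_1[of "- b" "cnj a" z] assms by auto
    then show "z \<in> disc_aut a b ` ball 0 1"
      by (metis image_eqI)
  qed
qed

text \<open>The automorphisms of the disc taking \<open>z\<close> to \<open>w\<close>: move \<open>z\<close> to the origin, rotate by
  \<open>e\<^sup>2\<close>, and move the origin to \<open>w\<close>.  With the square root
  \<open>e\<close> of the rotation as parameter, the matrix gets the symmetric form required by \<open>disc_aut\<close>.\<close>

definition transport :: "complex \<Rightarrow> complex \<Rightarrow> complex \<Rightarrow> complex \<Rightarrow> complex" where
  "transport z w e = disc_aut (e - cnj e * w * cnj z) (cnj e * w - e * z)"

lemma unit_cnj: "norm e = 1 \<Longrightarrow> e * cnj e = 1"
  by (metis complex_norm_square of_real_1 one_power2)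

lemma transport_determinant:
  assumes "norm e = 1"
  shows "(norm (e - cnj e * w * cnj z))\<^sup>2 - (norm (cnj e * w - e * z))\<^sup>2
          = (1 - (norm z)\<^sup>2) * (1 - (norm w)\<^sup>2)"
proof -
  have e: "e * cnj e = 1" by (rule unit_cnj[OF assms])
  have "complex_of_real ((norm (e - cnj e * w * cnj z))\<^sup>2 - (norm (cnj e * w - e * z))\<^sup>2)
     = e * cnj e * complex_of_real ((1 - (norm z)\<^sup>2) * (1 - (norm w)\<^sup>2))"
    unfolding of_real_diff of_real_mult of_real_1 complex_norm_square
    by (simp add: algebra_simps)
  then have "complex_of_real ((norm (e - cnj e * w * cnj z))\<^sup>2 - (norm (cnj e * w - e * z))\<^sup>2)
     = complex_of_real ((1 - (norm z)\<^sup>2) * (1 - (norm w)\<^sup>2))"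
    using e by simp
  then show ?thesis
    by (simp only: of_real_eq_iff)
qed

lemma one_minus_norm_square_pos: "norm (z::complex) < 1 \<Longrightarrow> 0 < 1 - (norm z)\<^sup>2"
  by (simp add: power_less_one_iff abs_square_less_1)

lemma transport_nondegenerate:
  assumes "norm e = 1" "norm z < 1" "norm w < 1"
  shows "norm (cnj e * w - e * z) < norm (e - cnj e * w * cnj z)"
proof -
  have "0 < (1 - (norm z)\<^sup>2) * (1 - (norm w)\<^sup>2)"
    using assms one_minus_norm_square_pos by (intro mult_pos_pos) auto
  then show ?thesis
    using transport_determinant[OF assms(1), of w z] power2_less_imp_less[OF _ norm_ge_zero] by smt
qed

lemma transport_denom:
  assumes "norm e = 1"
  shows "cnj (cnj e * w - e * z) * z + cnj (e - cnj e * w * cnj z) = cnj e * (1 - (norm z)\<^sup>2)"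
  unfolding of_real_diff of_real_1 complex_norm_square by (simp add: algebra_simps)

lemma transport_apply:
  assumes "norm e = 1" "norm z < 1"
  shows "transport z w e z = w"
proof -
  have "(e - cnj e * w * cnj z) * z + (cnj e * w - e * z) = w * (cnj e * (1 - (norm z)\<^sup>2))"
    unfolding of_real_diff of_real_1 complex_norm_square by (simp add: algebra_simps)
  moreover have "cnj e * (1 - (norm z)\<^sup>2) \<noteq> 0"
    using one_minus_norm_square_pos[OF assms(2)] assms(1)
    by (metis complex_cnj_zero_iff mult_eq_0_iff norm_zero of_real_eq_0_iff order_less_irrefl zero_neq_one)
  ultimately show ?thesis
    unfolding transport_def disc_aut_def transport_denom[OF assms(1)] by simp
qed

lemma transport_derivative:
  assumes "norm e = 1" "norm z < 1" "norm w < 1"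
  shows "(transport z w e has_field_derivative
            e\<^sup>2 * of_real ((1 - (norm w)\<^sup>2) / (1 - (norm z)\<^sup>2))) (at z)"
proof -
  have e: "e * cnj e = 1" by (rule unit_cnj[OF assms(1)])
  have "complex_of_real (1 - (norm z)\<^sup>2) \<noteq> 0"
    using one_minus_norm_square_pos[OF assms(2)] by (metis less_irrefl of_real_eq_0_iff)
  then have nz: "complex_of_real (1 - (norm z)\<^sup>2) \<noteq> 0" "e \<noteq> 0" "cnj e \<noteq> 0"
    using e by auto
  have "1 / cnj e = e" using e nz by (simp add: field_simps)
  then have "1 / (cnj e)\<^sup>2 = e\<^sup>2" by (metis power_one_over)
  moreover have "X * Y / (cnj e * X)\<^sup>2 = 1 / (cnj e)\<^sup>2 * (Y / X)" if "X \<noteq> 0" for X Y :: complex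
    using that nz by (simp add: field_simps power2_eq_square)
  ultimately have eq: "of_real ((1 - (norm z)\<^sup>2) * (1 - (norm w)\<^sup>2)) / (cnj e * of_real (1 - (norm z)\<^sup>2))\<^sup>2
      = e\<^sup>2 * of_real ((1 - (norm w)\<^sup>2) / (1 - (norm z)\<^sup>2))"
    unfolding of_real_mult of_real_divide using nz(1) by presburger
  show ?thesis
    using disc_aut_has_field_derivative[OF transport_nondegenerate[OF assms], of z] assms(2)
    unfolding transport_def transport_denom[OF assms(1)] transport_determinant[OF assms(1)] eq by simp
qed

text \<open>Conjugating with the automorphisms that move \<open>a\<close> and \<open>f a\<close> to the origin reduces this to the
  Schwarz lemma.  In the extremal case the conjugated map is the rotation by some \<open>c\<close>, and any square
  root of \<open>c\<close> serves as parameter of \<open>transport\<close>.\<close>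

lemma schwarz_pick:
  assumes holf: "f holomorphic_on ball 0 1" and fD: "f ` ball 0 1 \<subseteq> ball 0 1" and a: "norm a < 1"
  shows "norm (deriv f a) * (1 - (norm a)\<^sup>2) \<le> 1 - (norm (f a))\<^sup>2"
    and "norm (deriv f a) * (1 - (norm a)\<^sup>2) = 1 - (norm (f a))\<^sup>2 \<Longrightarrow>
           \<exists>e. norm e = 1 \<and> (\<forall>z\<in>ball 0 1. f z = transport a (f a) e z)"
proof -
  define A where "A = 1 - (norm a)\<^sup>2"
  define B where "B = 1 - (norm (f a))\<^sup>2"
  have fD': "norm (f z) < 1" if "norm z < 1" for z
    using fD that by (auto simp: image_subset_iff)
  have fa: "norm (f a) < 1" using fD' a by auto
  have pos: "A > 0" "B > 0" 
    unfolding A_def B_def using a fa one_minus_norm_square_pos by auto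
  define g where "g = disc_aut 1 (- f a) \<circ> (f \<circ> disc_aut 1 a)"
  have lt: "norm a < norm (1::complex)" "norm (- f a) < norm (1::complex)" using a fa by auto
  have holg: "g holomorphic_on ball 0 1"
    unfolding g_def
    by (rule holomorphic_on_compose_gen[OF holomorphic_on_compose_gen[OF disc_aut_holomorphic[OF lt(1)] holf]
          disc_aut_holomorphic[OF lt(2)]])
       (use disc_aut_image_ball[OF lt(1)] fD in auto)
  have g0: "g 0 = 0" by (simp add: g_def disc_aut_def)
  have gD: "norm (g z) < 1" if "norm z < 1" for z
    using disc_aut_norm_less_1[OF lt(2)] disc_aut_norm_less_1[OF lt(1) that] fD'
    unfolding g_def by auto
  have d1: "(disc_aut 1 a has_field_derivative of_real A) (at 0)"
    using disc_aut_has_field_derivative[OF lt(1), of 0] by (simp add: A_def)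
  have a0: "disc_aut 1 a 0 = a" by (simp add: disc_aut_def)
  have d2: "(f has_field_derivative deriv f a) (at (disc_aut 1 a 0))"
    unfolding a0 using holomorphic_derivI[OF holf] a by auto
  have fafa: "f a * cnj (f a) = of_real (1 - B)"
    unfolding B_def by (simp only: diff_diff_eq2 complex_norm_square add_diff_cancel_left')
  have den: "cnj (- f a) * f a + cnj 1 = of_real B"
    using fafa by (simp add: mult.commute)
  have num: "(norm (1::complex))\<^sup>2 - (norm (- f a))\<^sup>2 = B" by (simp add: B_def)
  have d3: "(disc_aut 1 (- f a) has_field_derivative 1 / of_real B) (at ((f \<circ> disc_aut 1 a) 0))"
    using disc_aut_has_field_derivative[OF lt(2), of "f a"] fa pos
    unfolding den num by (simp add: a0 power2_eq_square)
  have "(g has_field_derivative 1 / of_real B * (deriv f a * of_real A)) (at 0)"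
    unfolding g_def by (rule DERIV_chain[OF d3 DERIV_chain[OF d2 d1]])
  then have dg: "norm (deriv g 0) = norm (deriv f a) * A / B"
    using pos by (simp add: DERIV_imp_deriv norm_mult norm_divide)
  note S = Schwarz_Lemma'[OF holg g0 gD]
  show "norm (deriv f a) * (1 - (norm a)\<^sup>2) \<le> 1 - (norm (f a))\<^sup>2"
    using S pos unfolding dg A_def[symmetric] B_def[symmetric] by (simp add: field_simps)
  assume "norm (deriv f a) * (1 - (norm a)\<^sup>2) = 1 - (norm (f a))\<^sup>2"
  then have "norm (deriv g 0) = 1"
    unfolding dg A_def[symmetric] B_def[symmetric] using pos by simp
  then obtain c where c: "norm c = 1" "\<And>z. norm z < 1 \<Longrightarrow> g z = c * z"
    using S by blast
  define e where "e = csqrt c"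
  have e: "norm e = 1" "c = e\<^sup>2" using c(1) by (auto simp: e_def norm_csqrt)
  have ec: "e * cnj e = 1" by (rule unit_cnj[OF e(1)])
  have "f z = transport a (f a) e z" if z: "z \<in> ball 0 1" for z
  proof -
    define w where "w = disc_aut 1 (- a) z"
    have la: "norm (- a) < norm (1::complex)" using a by simp
    have w: "norm w < 1" "disc_aut 1 a w = z"
      unfolding w_def using disc_aut_norm_less_1[OF la] disc_aut_inverse[OF la, of z] z by auto
    have fz: "norm (f z) < 1" using fD' z by auto
    have "f z = disc_aut 1 (f a) (g w)"
      using w disc_aut_inverse[OF lt(2), of "f z"] fz by (simp add: g_def)
    also have "g w = e\<^sup>2 * w" using c(2)[OF w(1)] e by simp
    also have "disc_aut 1 (f a) (e\<^sup>2 * w) = transport a (f a) e z"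
    proof -
      have nz: "1 - cnj a * z \<noteq> 0"
        using disc_aut_denom_nonzero[OF la, of z] z by (simp add: add.commute)
      have e0: "e \<noteq> 0" "cnj e \<noteq> 0" using ec by auto
      have ci: "cnj e = 1 / e" using ec e0 by (simp add: field_simps)
      have w': "w = (z - a) / (1 - cnj a * z)" by (simp add: w_def disc_aut_def)
      have n1: "e\<^sup>2 * w + f a = e / (1 - cnj a * z) *
          ((e - cnj e * f a * cnj a) * z + (cnj e * f a - e * a))"
        using nz e0 unfolding w' ci by (simp add: field_simps power2_eq_square)
      have n2: "cnj (f a) * (e\<^sup>2 * w) + 1 = e / (1 - cnj a * z) *
          (cnj (cnj e * f a - e * a) * z + cnj (e - cnj e * f a * cnj a))"
        using nz e0 unfolding w' by (simp add: ci field_simps power2_eq_square)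
      show ?thesis
        unfolding transport_def disc_aut_def using n1 n2 e0 nz by simp
    qed
    finally show ?thesis .
  qed
  then show "\<exists>e. norm e = 1 \<and> (\<forall>z\<in>ball 0 1. f z = transport a (f a) e z)"
    using e(1) by blast
qed

section \<open>Symmetric functions on the bidisc\<close>

text \<open>The symmetrization map, under which the symmetrized bidisc is the quotient of the bidisc by
  the swap of coordinates.  A function on the symmetrized bidisc is handled throughout as a symmetric
  function on the bidisc.\<close>

definition sym_pair :: "complex \<Rightarrow> complex \<Rightarrow> complex^2" where
  "sym_pair z w = vector [z + w, z * w]"

lemma sym_pair_nth [simp]: "sym_pair z w $ 1 = z + w" "sym_pair z w $ 2 = z * w"
  by (simp_all add: sym_pair_def)

lemma sym_pair_commute: "sym_pair z w = sym_pair w z"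
  by (simp add: sym_pair_def ac_simps)

text \<open>Sum and product determine an unordered pair as the roots of a quadratic polynomial.\<close>

lemma sym_pair_eq_iff: "sym_pair z w = sym_pair z' w' \<longleftrightarrow> z = z' \<and> w = w' \<or> z = w' \<and> w = z'"
proof
  assume "sym_pair z w = sym_pair z' w'"
  then have s: "z + w = z' + w'" and p: "z * w = z' * w'"
    by (metis sym_pair_nth)+
  have "(z - z') * (z - w') = z * z - z * (z' + w') + z' * w'"
    by (simp add: algebra_simps)
  also have "\<dots> = 0"
    unfolding s[symmetric] p[symmetric] by (simp add: algebra_simps)
  finally show "z = z' \<and> w = w' \<or> z = w' \<and> w = z'"
    using s by auto
qed (auto simp: sym_pair_commute)

lemma symmetrized_bidisc_iff: "sym_pair z w \<in> symmetrized_bidisc \<longleftrightarrow> norm z < 1 \<and> norm w < 1"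
proof -
  have *: "symmetrized_bidisc = {sym_pair z w | z w. norm z < 1 \<and> norm w < 1}"
    by (simp add: symmetrized_bidisc_def sym_pair_def)
  show ?thesis unfolding * by (auto simp: sym_pair_eq_iff)
qed

lemma symmetrized_bidiscE:
  assumes "x \<in> symmetrized_bidisc"
  obtains z w where "x = sym_pair z w" "norm z < 1" "norm w < 1"
  using assms by (auto simp: symmetrized_bidisc_def sym_pair_def)

lemma has_derivative_curve_C2:
  fixes h :: "complex \<Rightarrow> complex^2"
  assumes "\<And>i. ((\<lambda>\<tau>. h \<tau> $ i) has_field_derivative v $ i) (at t)"
  shows "(h has_derivative (\<lambda>\<tau>. \<tau> *s v)) (at t)"
proof -
  have "((\<lambda>\<tau>. h \<tau> $ i) has_derivative (\<lambda>\<tau>. (\<tau> *s v) $ i)) (at t)" for i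
    using assms[of i] by (simp add: has_field_derivative_def mult.commute[of _ "v $ i"] cong: if_cong)
  then show ?thesis
    by (subst has_derivative_componentwise_within)
       (auto simp: Basis_vec_def inner_axis intro!: has_derivative_inner_left)
qed

lemma holomorphic_C2_along_curve:
  fixes h :: "complex \<Rightarrow> complex^2"
  assumes L: "Vector_Spaces.linear (*s) (*) L" "(\<Phi> has_derivative L) (at (h t))"
    and h: "\<And>i. ((\<lambda>\<tau>. h \<tau> $ i) has_field_derivative v $ i) (at t)"
  shows "((\<lambda>\<tau>. \<Phi> (h \<tau>)) has_field_derivative L v) (at t)"
proof -
  interpret L: Vector_Spaces.linear "(*s)" "(*)" L by (rule L(1))
  have "(h has_derivative (\<lambda>\<tau>. \<tau> *s v)) (at t)"
    by (rule has_derivative_curve_C2) (rule h)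
  then have "(\<Phi> \<circ> h has_derivative (L \<circ> (\<lambda>\<tau>. \<tau> *s v))) (at t)"
    by (rule diff_chain_at) (rule L(2))
  moreover have "L \<circ> (\<lambda>\<tau>. \<tau> *s v) = (*) (L v)"
    by (auto simp: fun_eq_iff L.scale)
  ultimately show ?thesis
    by (simp add: has_field_derivative_def o_def)
qed

lemma sym_pair_curve_derivative:
  assumes "(g1 has_field_derivative u) (at t)" "(g2 has_field_derivative v) (at t)"
  shows "((\<lambda>\<tau>. sym_pair (g1 \<tau>) (g2 \<tau>) $ i) has_field_derivative
           (u *s vector [1, g2 t] + v *s vector [1, g1 t]) $ i) (at t)"
  using exhaust_2[of i] assms by (auto intro!: derivative_eq_intros)

text \<open>The coefficients \<open>A\<close> and \<open>B\<close> are the two partial derivatives of the pullback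
  \<open>(z, w) \<mapsto> \<Phi> (sym_pair z w)\<close>.  Stating the chain rule for all pairs of curves avoids a separate notion
  of a holomorphic function on the bidisc.\<close>

lemma holomorphic_along_pair:
  assumes "holomorphic_C2 \<Phi> symmetrized_bidisc" "norm z < 1" "norm w < 1"
  obtains A B where "\<And>g1 g2 t u v. \<lbrakk>(g1 has_field_derivative u) (at t);
      (g2 has_field_derivative v) (at t); g1 t = z; g2 t = w\<rbrakk> \<Longrightarrow>
      ((\<lambda>\<tau>. \<Phi> (sym_pair (g1 \<tau>) (g2 \<tau>))) has_field_derivative A * u + B * v) (at t)"
proof -
  obtain L where L: "Vector_Spaces.linear (*s) (*) L" "(\<Phi> has_derivative L) (at (sym_pair z w))"
    using assms unfolding holomorphic_C2_def by (metis symmetrized_bidisc_iff)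
  interpret L: Vector_Spaces.linear "(*s)" "(*)" L by (rule L(1))
  show ?thesis
  proof (rule that)
    fix g1 g2 :: "complex \<Rightarrow> complex" and t u v
    assume g: "(g1 has_field_derivative u) (at t)" "(g2 has_field_derivative v) (at t)"
      "g1 t = z" "g2 t = w"
    have "((\<lambda>\<tau>. \<Phi> (sym_pair (g1 \<tau>) (g2 \<tau>))) has_field_derivative
        L (u *s vector [1, g2 t] + v *s vector [1, g1 t])) (at t)"
      by (rule holomorphic_C2_along_curve[OF L(1) _ sym_pair_curve_derivative[OF g(1,2)]])
         (use L(2) g(3,4) in simp)
    then show "((\<lambda>\<tau>. \<Phi> (sym_pair (g1 \<tau>) (g2 \<tau>))) has_field_derivative
        L (vector [1, w]) * u + L (vector [1, z]) * v) (at t)"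
      using g(3,4) by (simp add: L.add L.scale mult.commute)
  qed
qed

lemma holomorphic_along_discs:
  assumes "holomorphic_C2 \<Phi> symmetrized_bidisc" 
    "g1 holomorphic_on ball 0 1" "g2 holomorphic_on ball 0 1"
    "g1 ` ball 0 1 \<subseteq> ball 0 1" "g2 ` ball 0 1 \<subseteq> ball 0 1"
  shows "(\<lambda>t. \<Phi> (sym_pair (g1 t) (g2 t))) holomorphic_on ball 0 1"
proof (rule holomorphic_onI)
  fix t :: complex assume t: "t \<in> ball 0 1"
  then have n: "norm (g1 t) < 1" "norm (g2 t) < 1"
    using assms by (auto simp: image_subset_iff)
  obtain A B where *: "\<And>h1 h2 s u v. \<lbrakk>(h1 has_field_derivative u) (at s);
      (h2 has_field_derivative v) (at s); h1 s = g1 t; h2 s = g2 t\<rbrakk> \<Longrightarrow>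
      ((\<lambda>\<tau>. \<Phi> (sym_pair (h1 \<tau>) (h2 \<tau>))) has_field_derivative A * u + B * v) (at s)"
    using holomorphic_along_pair[OF assms(1) n] by metis
  have "((\<lambda>\<tau>. \<Phi> (sym_pair (g1 \<tau>) (g2 \<tau>))) has_field_derivative A * deriv g1 t + B * deriv g2 t) (at t)"
    using assms t by (intro *) (auto intro: holomorphic_derivI)
  then show "(\<lambda>t. \<Phi> (sym_pair (g1 t) (g2 t))) field_differentiable at t within ball 0 1"
    by (auto simp: field_differentiable_def intro: has_field_derivative_at_within)
qed

lemma norm_align: "\<exists>\<alpha>::complex. norm \<alpha> = 1 \<and> A * \<alpha> = of_real (norm A)"
proof (cases "A = 0")
  case False
  have "A * (cnj A / of_real (norm A)) = of_real (norm A)"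
    using False complex_norm_square[of A] by (simp add: power2_eq_square field_simps)
  moreover have "norm (cnj A / of_real (norm A)) = 1"
    using False by (simp add: norm_divide)
  ultimately show ?thesis by blast
qed (auto intro: exI[of _ 1])

text \<open>Infinitesimal Schwarz-Pick inequality on the bidisc: restrict the pullback of \<open>\<Phi>\<close> to the disc
  \<open>t \<mapsto> (M (\<alpha> t), N (\<beta> t))\<close>, where \<open>M\<close> and \<open>N\<close> are automorphisms moving the origin to \<open>z\<close> and
  \<open>w\<close>.  The unimodular numbers \<open>\<alpha>\<close> and \<open>\<beta>\<close> are chosen to align the phases of the two partial
  derivatives, which turns the modulus of the sum into the sum of the moduli.\<close>

lemma bidisc_schwarz_pick:
  assumes \<Phi>: "holomorphic_C2 \<Phi> symmetrized_bidisc" "\<Phi> ` symmetrized_bidisc \<subseteq> ball 0 1"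
    and zw: "norm z < 1" "norm w < 1"
  obtains A B where
    "\<And>g1 g2 t u v. \<lbrakk>(g1 has_field_derivative u) (at t); (g2 has_field_derivative v) (at t);
      g1 t = z; g2 t = w\<rbrakk> \<Longrightarrow>
      ((\<lambda>\<tau>. \<Phi> (sym_pair (g1 \<tau>) (g2 \<tau>))) has_field_derivative A * u + B * v) (at t)"
    "norm A * (1 - (norm z)\<^sup>2) + norm B * (1 - (norm w)\<^sup>2) \<le> 1 - (norm (\<Phi> (sym_pair z w)))\<^sup>2"
proof -
  obtain A B where AB: "\<And>g1 g2 t u v. \<lbrakk>(g1 has_field_derivative u) (at t);
      (g2 has_field_derivative v) (at t); g1 t = z; g2 t = w\<rbrakk> \<Longrightarrow>
      ((\<lambda>\<tau>. \<Phi> (sym_pair (g1 \<tau>) (g2 \<tau>))) has_field_derivative A * u + B * v) (at t)"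
    using holomorphic_along_pair[OF \<Phi>(1) zw] by metis
  obtain \<alpha> \<beta> where \<alpha>: "norm \<alpha> = 1" "A * \<alpha> = of_real (norm A)" 
    and \<beta>: "norm \<beta> = 1" "B * \<beta> = of_real (norm B)"
    using norm_align by metis
  define d where "d a \<gamma> = (\<lambda>t. disc_aut 1 a (\<gamma> * t))" for a \<gamma>
  have d: "d a \<gamma> holomorphic_on ball 0 1" "d a \<gamma> ` ball 0 1 \<subseteq> ball 0 1" "d a \<gamma> 0 = a"
    "(d a \<gamma> has_field_derivative \<gamma> * of_real (1 - (norm a)\<^sup>2)) (at 0)" 
    if "norm a < 1" "norm \<gamma> = 1" for a \<gamma>
  proof -
    have a: "norm a < norm (1::complex)" using that by simp
    show "d a \<gamma> holomorphic_on ball 0 1"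
      unfolding d_def using that
      by (intro holomorphic_on_compose_gen[OF _ disc_aut_holomorphic[OF a], unfolded o_def])
         (auto intro!: holomorphic_intros simp: norm_mult)
    show "d a \<gamma> ` ball 0 1 \<subseteq> ball 0 1"
      using that disc_aut_norm_less_1[OF a] by (auto simp: d_def norm_mult)
    show "d a \<gamma> 0 = a" by (simp add: d_def disc_aut_def)
    have "(disc_aut 1 a has_field_derivative of_real (1 - (norm a)\<^sup>2)) (at (\<gamma> * 0))"
      using disc_aut_has_field_derivative[OF a, of 0] by simp
    from DERIV_chain2[OF this DERIV_cmult_Id]
    show "(d a \<gamma> has_field_derivative \<gamma> * of_real (1 - (norm a)\<^sup>2)) (at 0)"
      unfolding d_def by (simp add: mult.commute)
  qed
  define g where "g = (\<lambda>t. \<Phi> (sym_pair (d z \<alpha> t) (d w \<beta> t)))"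
  note dz = d[OF zw(1) \<alpha>(1)] and dw = d[OF zw(2) \<beta>(1)]
  have holg: "g holomorphic_on ball 0 1"
    unfolding g_def by (rule holomorphic_along_discs[OF \<Phi>(1) dz(1) dw(1) dz(2) dw(2)])
  have gD: "g ` ball 0 1 \<subseteq> ball 0 1"
  proof -
    have "sym_pair (d z \<alpha> t) (d w \<beta> t) \<in> symmetrized_bidisc" if "t \<in> ball 0 1" for t
      using dz(2) dw(2) that by (auto simp: symmetrized_bidisc_iff image_subset_iff)
    then show ?thesis using \<Phi>(2) unfolding g_def by blast
  qed
  have "(g has_field_derivative A * (\<alpha> * of_real (1 - (norm z)\<^sup>2)) + B * (\<beta> * of_real (1 - (norm w)\<^sup>2))) (at 0)"
    unfolding g_def by (rule AB[OF dz(4) dw(4) dz(3) dw(3)])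
  moreover have "A * (\<alpha> * of_real (1 - (norm z)\<^sup>2)) + B * (\<beta> * of_real (1 - (norm w)\<^sup>2))
      = of_real (norm A * (1 - (norm z)\<^sup>2) + norm B * (1 - (norm w)\<^sup>2))"
    using \<alpha>(2) \<beta>(2) by (simp only: mult.assoc[symmetric] of_real_mult of_real_add)
  ultimately have "deriv g 0 = of_real (norm A * (1 - (norm z)\<^sup>2) + norm B * (1 - (norm w)\<^sup>2))"
    by (simp add: DERIV_imp_deriv)
  moreover have "0 \<le> norm A * (1 - (norm z)\<^sup>2) + norm B * (1 - (norm w)\<^sup>2)"
    using zw one_minus_norm_square_pos by (intro add_nonneg_nonneg mult_nonneg_nonneg) (auto intro: less_imp_le)
  moreover have "g 0 = \<Phi> (sym_pair z w)"
    using dz(3) dw(3) by (simp add: g_def)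
  ultimately show ?thesis
    using schwarz_pick(1)[OF holg gD, of 0] by (intro that[OF AB]) (auto simp del: of_real_add of_real_mult of_real_diff)
qed

lemma holomorphic_C2_compose:
  assumes "holomorphic_C2 \<Phi> S" "\<Phi> ` S \<subseteq> T" "g holomorphic_on T" "open T"
  shows "holomorphic_C2 (\<lambda>x. g (\<Phi> x)) S"
  unfolding holomorphic_C2_def
proof
  fix x assume x: "x \<in> S"
  obtain L where L: "Vector_Spaces.linear (*s) (*) L" "(\<Phi> has_derivative L) (at x)"
    using assms(1) x unfolding holomorphic_C2_def by blast
  interpret L: Vector_Spaces.linear "(*s)" "(*)" L by (rule L(1))
  have "Vector_Spaces.linear (*s) (*) (\<lambda>v. deriv g (\<Phi> x) * L v)"
    by unfold_locales (simp_all add: L.add L.scale algebra_simps)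
  moreover have "(g has_derivative (*) (deriv g (\<Phi> x))) (at (\<Phi> x))"
    using holomorphic_derivI[OF assms(3,4)] assms(2) x
    unfolding has_field_derivative_def by blast
  from diff_chain_at[OF L(2) this]
  have "((\<lambda>x. g (\<Phi> x)) has_derivative (\<lambda>v. deriv g (\<Phi> x) * L v)) (at x)"
    by (simp add: o_def)
  ultimately show "\<exists>L. Vector_Spaces.linear (*s) (*) L \<and> ((\<lambda>x. g (\<Phi> x)) has_derivative L) (at x)"
    by blast
qed

section \<open>Rigidity of geodesics that avoid the royal variety\<close>

lemma transport_inverse:
  assumes "norm e = 1" "norm z < 1" "norm w < 1" "norm t \<le> 1"
  shows "transport w z (cnj e) (transport z w e t) = t"
  using disc_aut_inverse[OF transport_nondegenerate[OF assms(1-3)] assms(4)]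
  by (simp add: transport_def mult_ac)

lemma transport_image_ball:
  assumes "norm e = 1" "norm z < 1" "norm w < 1"
  shows "transport z w e ` ball 0 1 = ball 0 1"
  unfolding transport_def by (rule disc_aut_image_ball[OF transport_nondegenerate[OF assms]])

lemma disc_aut_schwarz_pick_equality:
  assumes "norm b < norm a" "norm z < 1"
  shows "norm (deriv (disc_aut a b) z) * (1 - (norm z)\<^sup>2) = 1 - (norm (disc_aut a b z))\<^sup>2"
proof -
  define d where "d = (norm (cnj b * z + cnj a))\<^sup>2"
  have d: "d > 0"
    using disc_aut_denom_nonzero[OF assms(1), of z] assms(2) by (simp add: d_def)
  have pos: "0 < (norm a)\<^sup>2 - (norm b)\<^sup>2"
    using assms(1) by (auto intro: power_strict_mono)
  have "deriv (disc_aut a b) z = of_real ((norm a)\<^sup>2 - (norm b)\<^sup>2) / (cnj b * z + cnj a)\<^sup>2"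
    using disc_aut_has_field_derivative[OF assms(1), of z] assms(2) by (simp add: DERIV_imp_deriv)
  then have speed: "norm (deriv (disc_aut a b) z) = ((norm a)\<^sup>2 - (norm b)\<^sup>2) / d"
    using pos by (simp only: norm_divide norm_of_real norm_power d_def abs_of_pos)
  have modulus: "(norm (disc_aut a b z))\<^sup>2 = (norm (a * z + b))\<^sup>2 / d"
    by (simp add: disc_aut_def norm_divide power_divide d_def)
  have "((norm a)\<^sup>2 - (norm b)\<^sup>2) * (1 - (norm z)\<^sup>2) = d - (norm (a * z + b))\<^sup>2"
    using disc_aut_norm_identity[of b z a] unfolding d_def by simp
  with speed have "norm (deriv (disc_aut a b) z) * (1 - (norm z)\<^sup>2) = (d - (norm (a * z + b))\<^sup>2) / d"
    by (simp only: times_divide_eq_left)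
  then show ?thesis
    using d modulus by (simp add: diff_divide_distrib)
qed

text \<open>Equality at one point makes the map an automorphism, and automorphisms give equality at every
  point.  Hence the base point \<open>z\<close> of the \<open>transport\<close> representation can be chosen freely.\<close>

lemma schwarz_pick_equality_everywhere:
  assumes holf: "f holomorphic_on ball 0 1" and fD: "f ` ball 0 1 \<subseteq> ball 0 1"
    and a: "norm a < 1" "norm (deriv f a) * (1 - (norm a)\<^sup>2) = 1 - (norm (f a))\<^sup>2"
    and z: "norm z < 1"
  obtains e where "norm e = 1" "\<And>t. norm t < 1 \<Longrightarrow> f t = transport z (f z) e t"
proof -
  obtain e where e: "norm e = 1" "\<And>t. t \<in> ball 0 1 \<Longrightarrow> f t = transport a (f a) e t"
    using schwarz_pick(2)[OF holf fD a] by blast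
  have fa: "norm (f a) < 1" using fD a by (auto simp: image_subset_iff)
  have "eventually (\<lambda>t. t \<in> ball 0 1) (nhds z)"
    using z by (intro eventually_nhds_in_open) auto
  then have "eventually (\<lambda>t. f t = transport a (f a) e t) (nhds z)"
    by eventually_elim (use e in auto)
  then have "deriv f z = deriv (transport a (f a) e) z"
    by (rule deriv_cong_ev) simp
  then have "norm (deriv f z) * (1 - (norm z)\<^sup>2) = 1 - (norm (f z))\<^sup>2"
    using disc_aut_schwarz_pick_equality[OF transport_nondegenerate[OF e(1) a(1) fa] z] e(2)[of z] z
    unfolding transport_def by simp
  then show ?thesis
    using schwarz_pick(2)[OF holf fD z] that by auto
qed

lemma holomorphic_id_at_fixed_point:
  assumes holg: "g holomorphic_on ball 0 1" and gD: "g ` ball 0 1 \<subseteq> ball 0 1"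
    and a: "norm a < 1" "g a = a" "(g has_field_derivative 1) (at a)" and z: "norm z < 1"
  shows "g z = z"
proof -
  have "deriv g a = 1" using a(3) by (rule DERIV_imp_deriv)
  then obtain e where e: "norm e = 1" "\<And>z. z \<in> ball 0 1 \<Longrightarrow> g z = transport a a e z"
    using schwarz_pick(2)[OF holg gD a(1)] a(2) by auto
  have "(g has_field_derivative e\<^sup>2 * of_real ((1 - (norm a)\<^sup>2) / (1 - (norm a)\<^sup>2))) (at a)"
    by (rule has_field_derivative_transform_within_open
          [OF transport_derivative[OF e(1) a(1) a(1)], of "ball 0 1"])
       (use e(2) a(1) in auto)
  then have "e\<^sup>2 * of_real ((1 - (norm a)\<^sup>2) / (1 - (norm a)\<^sup>2)) = 1"
    using a(3) DERIV_unique by blast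
  then have "e\<^sup>2 = 1"
    using one_minus_norm_square_pos[OF a(1)] by auto
  then have "e = 1 \<or> e = - 1" by (simp add: power2_eq_1_iff)
  moreover have "1 - a * cnj a \<noteq> 0"
  proof -
    have "1 - a * cnj a = of_real (1 - (norm a)\<^sup>2)" 
      by (simp only: of_real_diff of_real_1 complex_norm_square)
    then show ?thesis
      using one_minus_norm_square_pos[OF a(1)] by (metis less_irrefl of_real_eq_0_iff)
  qed
  moreover have "a * cnj a - 1 \<noteq> 0" "- 1 + a * cnj a \<noteq> 0"
    using \<open>1 - a * cnj a \<noteq> 0\<close> by auto
  ultimately have "transport a a e z = z"
    unfolding transport_def disc_aut_def by (auto simp: mult.commute)
  then show ?thesis using e z by auto
qed

text \<open>If a geodesic is the graph of a self-map \<open>f\<close> of the disc without fixed points, then \<open>f\<close> is an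
  automorphism.  Suppose it is not, and let \<open>A\<close>, \<open>B\<close> be the partial derivatives of the pullback of
  \<open>\<Phi>\<close> at \<open>(t, f t)\<close>.  Differentiating the identity \<open>\<Phi> (sym_pair t (f t)) = t\<close> gives
  \<open>A + B f'(t) = 1\<close>, and the strict Schwarz-Pick inequality for \<open>f\<close> then contradicts the one on the
  bidisc unless \<open>B = 0\<close> and \<open>A = 1\<close>.  So \<open>z \<mapsto> \<Phi> (sym_pair z (f t))\<close> fixes \<open>t\<close> with derivative 1
  and is the identity.  Evaluating \<open>\<Phi>\<close> at the pair of \<open>f s\<close> and \<open>f t\<close> in both orders yields
  \<open>f s = f t\<close>, so \<open>f\<close> is constant, and a constant self-map of the disc has a fixed point.\<close>

lemma left_inverse_rigidity:
  assumes \<Phi>: "holomorphic_C2 \<Phi> symmetrized_bidisc" "\<Phi> ` symmetrized_bidisc \<subseteq> ball 0 1"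
    and holf: "f holomorphic_on ball 0 1" and fD: "f ` ball 0 1 \<subseteq> ball 0 1"
    and inv: "\<And>t. norm t < 1 \<Longrightarrow> \<Phi> (sym_pair t (f t)) = t"
    and nofix: "\<And>t. norm t < 1 \<Longrightarrow> f t \<noteq> t"
  obtains a where "norm a < 1" "norm (deriv f a) * (1 - (norm a)\<^sup>2) = 1 - (norm (f a))\<^sup>2"
proof -
  have fD': "norm (f t) < 1" if "norm t < 1" for t
    using fD that by (auto simp: image_subset_iff)
  have \<Phi>D: "norm (\<Phi> (sym_pair z w)) < 1" if "norm z < 1" "norm w < 1" for z w
    using \<Phi>(2) that by (auto simp: image_subset_iff symmetrized_bidisc_iff)
  have False if strict: "\<And>a. norm a < 1 \<Longrightarrow> norm (deriv f a) * (1 - (norm a)\<^sup>2) < 1 - (norm (f a))\<^sup>2"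
  proof -
    have slice: "\<Phi> (sym_pair z (f t)) = z" if t: "norm t < 1" and z: "norm z < 1" for t z
    proof -
      obtain A B where AB: 
        "\<And>g1 g2 s u v. \<lbrakk>(g1 has_field_derivative u) (at s); (g2 has_field_derivative v) (at s);
          g1 s = t; g2 s = f t\<rbrakk> \<Longrightarrow>
          ((\<lambda>\<tau>. \<Phi> (sym_pair (g1 \<tau>) (g2 \<tau>))) has_field_derivative A * u + B * v) (at s)"
        "norm A * (1 - (norm t)\<^sup>2) + norm B * (1 - (norm (f t))\<^sup>2) \<le> 1 - (norm (\<Phi> (sym_pair t (f t))))\<^sup>2"
        using bidisc_schwarz_pick[OF \<Phi> t fD'[OF t]] by blast
      have "((\<lambda>\<tau>. \<Phi> (sym_pair \<tau> (f \<tau>))) has_field_derivative A * 1 + B * deriv f t) (at t)"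
        using t by (intro AB(1) DERIV_ident holomorphic_derivI[OF holf]) auto
      moreover have "((\<lambda>\<tau>. \<Phi> (sym_pair \<tau> (f \<tau>))) has_field_derivative 1) (at t)"
        by (rule has_field_derivative_transform_within_open[OF DERIV_ident, of "ball 0 1"])
           (use t inv in auto)
      ultimately have one: "A + B * deriv f t = 1"
        using DERIV_unique by fastforce
      have pt: "1 - (norm t)\<^sup>2 > 0" using t by (rule one_minus_norm_square_pos)
      have "B = 0"
      proof (rule ccontr)
        assume "B \<noteq> 0"
        have "1 - (norm t)\<^sup>2 = norm (A + B * deriv f t) * (1 - (norm t)\<^sup>2)"
          using one by simp
        also have "\<dots> \<le> (norm A + norm B * norm (deriv f t)) * (1 - (norm t)\<^sup>2)"
          using pt by (intro mult_right_mono) (metis norm_triangle_ineq norm_mult, simp)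
        also have "\<dots> = norm A * (1 - (norm t)\<^sup>2) + norm B * (norm (deriv f t) * (1 - (norm t)\<^sup>2))"
          by (simp add: algebra_simps)
        also have "\<dots> < norm A * (1 - (norm t)\<^sup>2) + norm B * (1 - (norm (f t))\<^sup>2)"
          using strict[OF t] \<open>B \<noteq> 0\<close> by (intro add_strict_left_mono mult_strict_left_mono) auto
        also have "\<dots> \<le> 1 - (norm t)\<^sup>2"
          using AB(2) inv[OF t] by simp
        finally show False by simp
      qed
      then have "A = 1" using one by simp
      have "((\<lambda>z. \<Phi> (sym_pair z (f t))) has_field_derivative A * 1 + B * 0) (at t)"
        by (intro AB(1) DERIV_ident DERIV_const) auto
      then have d: "((\<lambda>z. \<Phi> (sym_pair z (f t))) has_field_derivative 1) (at t)"
        using \<open>A = 1\<close> by simp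
      show ?thesis
      proof (rule holomorphic_id_at_fixed_point[OF _ _ t inv[OF t] d z])
        show "(\<lambda>z. \<Phi> (sym_pair z (f t))) holomorphic_on ball 0 1"
          using fD'[OF t] by (intro holomorphic_along_discs[OF \<Phi>(1)] holomorphic_intros) auto
        show "(\<lambda>z. \<Phi> (sym_pair z (f t))) ` ball 0 1 \<subseteq> ball 0 1"
          using \<Phi>D fD'[OF t] by auto
      qed
    qed
    have const: "f t = f 0" if t: "norm t < 1" for t
      using slice[OF t fD'[of 0]] slice[of 0, OF _ fD'[OF t]] by (simp add: sym_pair_commute)
    show False
      using nofix[OF fD'[of 0]] const[OF fD'[of 0]] by simp
  qed
  then show ?thesis
    using that schwarz_pick(1)[OF holf fD] by (meson order_less_le)
qed

text \<open>A pair of self-maps with a left inverse on the bidisc cannot contract strictly in both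
  components.  The factor \<open>1 - (norm 0)\<^sup>2 = 1\<close> of the Schwarz-Pick equality is left out.\<close>

lemma one_component_automorphism:
  assumes \<Phi>: "holomorphic_C2 \<Phi> symmetrized_bidisc" "\<Phi> ` symmetrized_bidisc \<subseteq> ball 0 1"
    and hol: "f1 holomorphic_on ball 0 1" "f2 holomorphic_on ball 0 1"
    and D: "f1 ` ball 0 1 \<subseteq> ball 0 1" "f2 ` ball 0 1 \<subseteq> ball 0 1"
    and inv: "\<And>t. norm t < 1 \<Longrightarrow> \<Phi> (sym_pair (f1 t) (f2 t)) = t"
  shows "norm (deriv f1 0) = 1 - (norm (f1 0))\<^sup>2 \<or> norm (deriv f2 0) = 1 - (norm (f2 0))\<^sup>2"
proof (rule ccontr)
  assume "\<not> ?thesis"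
  then have strict: "norm (deriv f1 0) < 1 - (norm (f1 0))\<^sup>2" "norm (deriv f2 0) < 1 - (norm (f2 0))\<^sup>2"
    using schwarz_pick(1)[OF hol(1) D(1), of 0] schwarz_pick(1)[OF hol(2) D(2), of 0] by auto
  have n: "norm (f1 0) < 1" "norm (f2 0) < 1"
    using D by (auto simp: image_subset_iff)
  obtain A B where AB: 
    "\<And>g1 g2 s u v. \<lbrakk>(g1 has_field_derivative u) (at s); (g2 has_field_derivative v) (at s);
      g1 s = f1 0; g2 s = f2 0\<rbrakk> \<Longrightarrow>
      ((\<lambda>\<tau>. \<Phi> (sym_pair (g1 \<tau>) (g2 \<tau>))) has_field_derivative A * u + B * v) (at s)"
    "norm A * (1 - (norm (f1 0))\<^sup>2) + norm B * (1 - (norm (f2 0))\<^sup>2)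
        \<le> 1 - (norm (\<Phi> (sym_pair (f1 0) (f2 0))))\<^sup>2"
    using bidisc_schwarz_pick[OF \<Phi> n] by blast
  have "((\<lambda>\<tau>. \<Phi> (sym_pair (f1 \<tau>) (f2 \<tau>))) has_field_derivative A * deriv f1 0 + B * deriv f2 0) (at 0)"
    by (intro AB(1) holomorphic_derivI[OF hol(1)] holomorphic_derivI[OF hol(2)]) auto
  moreover have "((\<lambda>\<tau>. \<Phi> (sym_pair (f1 \<tau>) (f2 \<tau>))) has_field_derivative 1) (at 0)"
    by (rule has_field_derivative_transform_within_open[OF DERIV_ident, of "ball 0 1"])
       (use inv in auto)
  ultimately have one: "A * deriv f1 0 + B * deriv f2 0 = 1"
    using DERIV_unique by blast
  have "1 = norm (A * deriv f1 0 + B * deriv f2 0)"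
    using one by simp
  also have "\<dots> \<le> norm A * norm (deriv f1 0) + norm B * norm (deriv f2 0)"
    by (metis norm_triangle_ineq norm_mult)
  also have "\<dots> < norm A * (1 - (norm (f1 0))\<^sup>2) + norm B * (1 - (norm (f2 0))\<^sup>2)"
  proof (cases "A = 0")
    case True
    then have "B \<noteq> 0" using one by auto
    then show ?thesis using True strict by simp
  next
    case False
    then show ?thesis using strict
      by (intro add_less_le_mono mult_strict_left_mono mult_left_mono) auto
  qed
  also have "\<dots> \<le> 1"
    using AB(2) inv[of 0] by simp
  finally show False by simp
qed

lemma royal_variety_iff: "sym_pair z w \<in> royal_variety \<longleftrightarrow> z = w \<and> norm z < 1"
proof -
  have *: "royal_variety = {sym_pair z z | z. norm z < 1}"
    by (simp add: royal_variety_def sym_pair_def power2_eq_square)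
  show ?thesis unfolding * by (auto simp: sym_pair_eq_iff)
qed

text \<open>The discriminant \<open>s\<^sup>2 - 4 p\<close> is the square of the difference of the two roots and vanishes exactly
  on the royal variety.  A curve that avoids the royal variety therefore lifts through a holomorphic
  square root of the discriminant, which exists on the simply connected disc.\<close>

lemma lift_to_bidisc:
  assumes hol: "\<And>i. (\<lambda>t. h t $ i) holomorphic_on ball 0 1"
    and hG: "h ` ball 0 1 \<subseteq> symmetrized_bidisc" and hR: "h ` ball 0 1 \<inter> royal_variety = {}"
  obtains f1 f2 where "f1 holomorphic_on ball 0 1" "f2 holomorphic_on ball 0 1"
    "f1 ` ball 0 1 \<subseteq> ball 0 1" "f2 ` ball 0 1 \<subseteq> ball 0 1"
    "\<And>t. norm t < 1 \<Longrightarrow> h t = sym_pair (f1 t) (f2 t) \<and> f1 t \<noteq> f2 t"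
proof -
  define \<delta> where "\<delta> = (\<lambda>t. (h t $ 1)\<^sup>2 - 4 * (h t $ 2))"
  have roots: "\<exists>z w. h t = sym_pair z w \<and> norm z < 1 \<and> norm w < 1 \<and> z \<noteq> w" if "norm t < 1" for t
  proof -
    have "t \<in> ball 0 1" using that by simp
    then have t: "h t \<in> symmetrized_bidisc" "h t \<notin> royal_variety" using hG hR by blast+
    show ?thesis
      using symmetrized_bidiscE[OF t(1)] t(2) royal_variety_iff by metis
  qed
  have disc: "(sym_pair z w $ 1)\<^sup>2 - 4 * (sym_pair z w $ 2) = (z - w)\<^sup>2" for z w
    by (simp add: power2_eq_square algebra_simps)
  have "\<delta> holomorphic_on ball 0 1"
    unfolding \<delta>_def by (intro holomorphic_intros hol)
  moreover have nz: "\<delta> t \<noteq> 0" if "t \<in> ball 0 1" for t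
  proof -
    have "norm t < 1" using that by simp
    then obtain z w where "h t = sym_pair z w" "z \<noteq> w"
      using roots by metis
    then show ?thesis
      unfolding \<delta>_def using disc[of z w] by simp
  qed
  ultimately obtain q where q: "q holomorphic_on ball 0 1" "\<And>t. t \<in> ball 0 1 \<Longrightarrow> \<delta> t = (q t)\<^sup>2"
    using simply_connected_eq_holomorphic_sqrt[of "ball (0::complex) 1"]
      convex_imp_simply_connected[of "ball (0::complex) 1"] by auto
  define f1 f2 where "f1 = (\<lambda>t. (h t $ 1 + q t) / 2)" and "f2 = (\<lambda>t. (h t $ 1 - q t) / 2)"
  have f: "h t = sym_pair (f1 t) (f2 t) \<and> f1 t \<noteq> f2 t \<and> norm (f1 t) < 1 \<and> norm (f2 t) < 1"
    if t: "norm t < 1" for t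
  proof -
    obtain z w where zw: "h t = sym_pair z w" "norm z < 1" "norm w < 1" "z \<noteq> w"
      using roots[OF t] by blast
    have "(q t)\<^sup>2 = (z - w)\<^sup>2" using q(2)[of t] t zw(1) disc by (simp add: \<delta>_def)
    then have "q t = z - w \<or> q t = w - z" by (auto simp: power2_eq_iff)
    then have "f1 t = z \<and> f2 t = w \<or> f1 t = w \<and> f2 t = z"
      by (auto simp: f1_def f2_def zw(1))
    then show ?thesis using zw by (auto simp: sym_pair_commute)
  qed
  show ?thesis
  proof (rule that)
    show "f1 holomorphic_on ball 0 1" "f2 holomorphic_on ball 0 1"
      unfolding f1_def f2_def by (intro holomorphic_intros hol q; simp)+
  qed (use f in auto)
qed

text \<open>Lift the geodesic to the bidisc.  One component is an automorphism, and reparametrizing by its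
  inverse turns the geodesic into a graph over the disc; \<open>left_inverse_rigidity\<close> makes the other
  component an automorphism too.  The graph of an automorphism and that of its inverse have the same
  symmetrization, so the automorphism can be taken to map \<open>z1\<close> to \<open>z2\<close>.\<close>

lemma geodesic_avoiding_royal:
  assumes D: "geodesic D" "D \<inter> royal_variety = {}" and x: "sym_pair z1 z2 \<in> D"
  obtains e where "norm e = 1" "D = (\<lambda>t. sym_pair t (transport z1 z2 e t)) ` ball 0 1"
    "\<And>t. norm t < 1 \<Longrightarrow> transport z1 z2 e t \<noteq> t"
proof -
  obtain h \<Phi> where h: "\<And>i. (\<lambda>t. h t $ i) holomorphic_on ball 0 1"
      "h ` ball 0 1 \<subseteq> symmetrized_bidisc" "D = h ` ball 0 1"
    and \<Phi>: "holomorphic_C2 \<Phi> symmetrized_bidisc" "\<Phi> ` symmetrized_bidisc \<subseteq> ball 0 1"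
      "\<And>t. t \<in> ball 0 1 \<Longrightarrow> \<Phi> (h t) = t"
    using D(1) unfolding geodesic_def geodesic_map_def by blast
  have graph: "\<exists>e. norm e = 1 \<and> D = (\<lambda>t. sym_pair t (transport z1 z2 e t)) ` ball 0 1 \<and>
      (\<forall>t\<in>ball 0 1. transport z1 z2 e t \<noteq> t)"
    if hol: "f1 holomorphic_on ball 0 1" "f2 holomorphic_on ball 0 1"
      and fD: "f1 ` ball 0 1 \<subseteq> ball 0 1" "f2 ` ball 0 1 \<subseteq> ball 0 1"
      and f: "\<And>t. norm t < 1 \<Longrightarrow> h t = sym_pair (f1 t) (f2 t) \<and> f1 t \<noteq> f2 t"
      and eq: "norm (deriv f1 0) = 1 - (norm (f1 0))\<^sup>2" for f1 f2
  proof -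
    define w where "w = f1 0"
    have w: "norm w < 1" using fD(1) by (auto simp: w_def image_subset_iff)
    obtain e1 where e1: "norm e1 = 1" "\<And>t. norm t < 1 \<Longrightarrow> f1 t = transport 0 w e1 t"
      using schwarz_pick_equality_everywhere[OF hol(1) fD(1), of 0 0] eq by (auto simp: w_def)
    \<comment> \<open>The inverse of the automorphism \<open>f1\<close>.\<close>
    define k where "k = transport w 0 (cnj e1)"
    have kball: "k ` ball 0 1 = ball 0 1"
      unfolding k_def using e1(1) w by (intro transport_image_ball) auto
    then have kD: "norm (k t) < 1" if "norm t < 1" for t
      using that by (metis imageI mem_ball_0)
    have f1k: "f1 (k t) = t" if "norm t < 1" for t
      using transport_inverse[of "cnj e1" w 0 t] e1 w that kD[OF that] by (auto simp: k_def)
    have holk: "k holomorphic_on ball 0 1"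
      unfolding k_def transport_def using e1(1) w by (intro disc_aut_holomorphic transport_nondegenerate) auto
    define f where "f = (\<lambda>t. f2 (k t))"
    have holf: "f holomorphic_on ball 0 1"
      unfolding f_def using holomorphic_on_compose_gen[OF holk hol(2)] kball by (simp add: o_def)
    have f_ball: "f ` ball 0 1 \<subseteq> ball 0 1"
      using fD(2) kD by (auto simp: f_def image_subset_iff)
    define \<Psi> where "\<Psi> = (\<lambda>x. f1 (\<Phi> x))"
    have \<Psi>: "holomorphic_C2 \<Psi> symmetrized_bidisc" "\<Psi> ` symmetrized_bidisc \<subseteq> ball 0 1"
      unfolding \<Psi>_def using holomorphic_C2_compose[OF \<Phi>(1,2) hol(1)] \<Phi>(2) fD(1) 
      by (auto simp: image_subset_iff)
    have hk: "h (k t) = sym_pair t (f t)" if "norm t < 1" for t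
      using f[OF kD[OF that]] f1k[OF that] by (simp add: f_def)
    have inv: "\<Psi> (sym_pair t (f t)) = t" if "norm t < 1" for t
      using \<Phi>(3)[of "k t"] kD[OF that] f1k[OF that] by (simp add: \<Psi>_def flip: hk[OF that])
    have nofix: "f t \<noteq> t" if "norm t < 1" for t
      using f[OF kD[OF that]] f1k[OF that] by (auto simp: f_def)
    obtain a where a: "norm a < 1" "norm (deriv f a) * (1 - (norm a)\<^sup>2) = 1 - (norm (f a))\<^sup>2"
      using left_inverse_rigidity[OF \<Psi> holf f_ball inv nofix] by blast
    have Df: "D = (\<lambda>t. sym_pair t (f t)) ` ball 0 1"
    proof -
      have "D = h ` k ` ball 0 1" by (simp add: h(3) kball)
      also have "\<dots> = (\<lambda>t. sym_pair t (f t)) ` ball 0 1"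
        unfolding image_image using hk by (intro image_cong) auto
      finally show ?thesis .
    qed
    then obtain s where s: "norm s < 1" "sym_pair z1 z2 = sym_pair s (f s)"
      using x by auto
    obtain e where e: "norm e = 1" "\<And>t. norm t < 1 \<Longrightarrow> f t = transport s (f s) e t"
      using schwarz_pick_equality_everywhere[OF holf f_ball a s(1)] by blast
    have fs: "norm (f s) < 1" using f_ball s(1) by (auto simp: image_subset_iff)
    consider "s = z1" "f s = z2" | "s = z2" "f s = z1"
      using s(2) by (auto simp: sym_pair_eq_iff)
    then show ?thesis
    proof cases
      case 1
      then have "D = (\<lambda>t. sym_pair t (transport z1 z2 e t)) ` ball 0 1"
        unfolding Df using e(2) by (intro image_cong) auto
      then show ?thesis using 1 e nofix by auto
    next
      case 2
      \<comment> \<open>Here \<open>f\<close> maps \<open>z2\<close> to \<open>z1\<close>, so its inverse \<open>m\<close> is used instead.\<close>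
      define m where "m = transport z1 z2 (cnj e)"
      have z: "norm z1 < 1" "norm z2 < 1" using 2 s(1) fs by auto
      have fl: "f t = transport z2 z1 e t" if "norm t < 1" for t using e(2) that 2 by auto
      have mf: "m (f t) = t" if "norm t < 1" for t
        unfolding m_def fl[OF that] using e(1) z that by (intro transport_inverse) auto
      have "f ` ball 0 1 = transport z2 z1 e ` ball 0 1"
        using fl by (intro image_cong) auto
      then have fball: "f ` ball 0 1 = ball 0 1"
        by (simp only: transport_image_ball[OF e(1) z(2,1)])
      have "D = (\<lambda>t. sym_pair (f t) (m (f t))) ` ball 0 1"
        unfolding Df using mf by (intro image_cong) (auto simp: sym_pair_commute)
      also have "\<dots> = (\<lambda>t. sym_pair t (m t)) ` f ` ball 0 1"
        by (simp add: image_image)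
      finally have "D = (\<lambda>t. sym_pair t (m t)) ` ball 0 1"
        unfolding fball .
      moreover have "m t \<noteq> t" if t: "t \<in> ball 0 1" for t
      proof -
        obtain u where "u \<in> ball 0 1" "t = f u" using fball t by (metis imageE)
        then show ?thesis using mf[of u] nofix[of u] by auto
      qed
      ultimately show ?thesis
        unfolding m_def using e(1) by (intro exI[of _ "cnj e"]) auto
    qed
  qed
  obtain f1 f2 where f: "f1 holomorphic_on ball 0 1" "f2 holomorphic_on ball 0 1"
    "f1 ` ball 0 1 \<subseteq> ball 0 1" "f2 ` ball 0 1 \<subseteq> ball 0 1"
    "\<And>t. norm t < 1 \<Longrightarrow> h t = sym_pair (f1 t) (f2 t) \<and> f1 t \<noteq> f2 t"
    using lift_to_bidisc[OF h(1,2)] D(2) h(3) by metis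
  have "\<Phi> (sym_pair (f1 t) (f2 t)) = t" if "norm t < 1" for t
    using \<Phi>(3)[of t] f(5)[OF that] that by simp
  from one_component_automorphism[OF \<Phi>(1,2) f(1-4) this]
  have "\<exists>e. norm e = 1 \<and> D = (\<lambda>t. sym_pair t (transport z1 z2 e t)) ` ball 0 1 \<and>
      (\<forall>t\<in>ball 0 1. transport z1 z2 e t \<noteq> t)"
  proof
    assume "norm (deriv f1 0) = 1 - (norm (f1 0))\<^sup>2"
    then show ?thesis using graph[OF f] by blast
  next
    assume "norm (deriv f2 0) = 1 - (norm (f2 0))\<^sup>2"
    then show ?thesis using graph[OF f(2,1,4,3)] f(5) by (metis sym_pair_commute)
  qed
  then show ?thesis using that by auto
qed

section \<open>Geodesics from automorphisms with a boundary fixed point\<close>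

text \<open>The map \<open>\<zeta> \<mapsto> 1 / (1 - \<zeta>)\<close> sends the disc onto the half-plane \<open>Re v > 1 / 2\<close>, with inverse
  \<open>v \<mapsto> 1 - 1 / v\<close>.\<close>

lemma half_plane_of_disc: "norm \<zeta> < 1 \<Longrightarrow> Re (1 / (1 - \<zeta>)) > 1 / 2"
proof -
  assume "norm \<zeta> < 1"
  then have z: "(Re \<zeta>)\<^sup>2 + (Im \<zeta>)\<^sup>2 < 1" "\<zeta> \<noteq> 1"
    using one_minus_norm_square_pos[of \<zeta>] by (auto simp: cmod_power2)
  define d where "d = (1 - Re \<zeta>)\<^sup>2 + (Im \<zeta>)\<^sup>2"
  have "d > 0"
    unfolding d_def using z(2) by (auto simp: sum_power2_gt_zero_iff complex_eq_iff)
  have "Re (1 / (1 - \<zeta>)) = (1 - Re \<zeta>) / d"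
    by (simp add: Re_divide d_def)
  have "2 * (1 - Re \<zeta>) > d"
    using z(1) by (simp add: d_def power2_eq_square algebra_simps)
  with \<open>d > 0\<close> have "1 / 2 < (1 - Re \<zeta>) / d" by (simp add: field_simps)
  then show ?thesis unfolding \<open>Re (1 / (1 - \<zeta>)) = (1 - Re \<zeta>) / d\<close> .
qed

lemma disc_of_half_plane: "Re v > 1 / 2 \<Longrightarrow> norm (1 - 1 / v) < 1"
proof -
  assume v: "Re v > 1 / 2"
  then have "v \<noteq> 0" by auto
  then have "1 - 1 / v = (v - 1) / v" by (simp add: field_simps)
  moreover have "(norm (v - 1))\<^sup>2 < (norm v)\<^sup>2"
    using v unfolding cmod_power2 by (simp add: power2_eq_square algebra_simps)
  then have "norm (v - 1) < norm v"
    using power2_less_imp_less norm_ge_zero by blast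
  ultimately show ?thesis
    using \<open>v \<noteq> 0\<close> by (simp add: norm_divide)
qed

text \<open>In the half-plane coordinate that sends the boundary fixed point \<open>\<eta>\<close> to infinity, the automorphism
  fixes infinity and hence is affine.  It preserves the boundary line \<open>Re v = 1 / 2\<close>; this forces the
  slope to be positive and determines the real part of the translation.\<close>

lemma disc_aut_affine_at_fixed_point:
  assumes ab: "norm b < norm a" and \<eta>: "norm \<eta> = 1" "disc_aut a b \<eta> = \<eta>"
  obtains k :: real and l where "k > 0" "Re l = (1 - k) / 2"
    "\<And>t. norm t < 1 \<Longrightarrow> 1 / (1 - cnj \<eta> * disc_aut a b t) = of_real k * (1 / (1 - cnj \<eta> * t)) + l"
proof -
  have ec: "\<eta> * cnj \<eta> = 1" by (rule unit_cnj[OF \<eta>(1)])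
  define Q where "Q = cnj b * \<eta> + cnj a"
  have Q0: "Q \<noteq> 0" unfolding Q_def using disc_aut_denom_nonzero[OF ab, of \<eta>] \<eta> by simp
  have fx: "a * \<eta> + b = \<eta> * Q"
    using \<eta>(2) Q0 unfolding disc_aut_def Q_def[symmetric] by (simp add: divide_eq_eq)
  have "cnj Q = cnj \<eta> * (a * \<eta> + b)"
    using ec unfolding Q_def by (simp add: algebra_simps)
  also have "\<dots> = (\<eta> * cnj \<eta>) * Q" unfolding fx by (simp add: algebra_simps)
  finally have "cnj Q = Q" using ec by simp
  then obtain q where q: "Q = complex_of_real q"
    by (metis Reals_cnj_iff Reals_cases)
  have q0: "q \<noteq> 0" using Q0 q by simp
  define \<Delta> where "\<Delta> = (norm a)\<^sup>2 - (norm b)\<^sup>2"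
  have \<Delta>: "\<Delta> > 0" using ab by (auto simp: \<Delta>_def intro: power_strict_mono)
  have ca: "cnj a = of_real q - cnj b * \<eta>" using q Q_def by (metis add_diff_cancel_left')
  have a: "a = of_real q - b * cnj \<eta>"
    using arg_cong[OF ca, of cnj] by simp
  \<comment> \<open>The common factor of numerator and denominator: \<open>X (1 - cnj \<eta> * t)\<close> is the numerator of
      \<open>1 - cnj \<eta> * disc_aut a b t\<close>.\<close>
  define X where "X = of_real q - cnj b * \<eta> - cnj \<eta> * b"
  have "of_real \<Delta> = of_real q * X"
  proof -
    have "of_real \<Delta> = a * cnj a - b * cnj b"
      by (simp only: \<Delta>_def of_real_diff complex_norm_square)
    also have "\<dots> = (of_real q - b * cnj \<eta>) * (of_real q - cnj b * \<eta>) - b * cnj b"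
      by (subst ca, subst a) (rule refl)
    also have "\<dots> = of_real q * X + b * cnj b * (\<eta> * cnj \<eta> - 1)"
      by (simp add: X_def algebra_simps)
    finally show ?thesis using ec by simp
  qed
  then have X: "X = of_real (\<Delta> / q)"
    using q0 by (simp add: field_simps)
  define k l where "k = q\<^sup>2 / \<Delta>" and "l = - of_real (q / \<Delta>) * (cnj b * \<eta>)"
  have "\<Delta> / q = q - 2 * Re (cnj b * \<eta>)"
    using arg_cong[OF X, of Re] unfolding X_def by (simp add: algebra_simps)
  then have "Re (cnj b * \<eta>) = (q - \<Delta> / q) / 2" by simp
  moreover have "l = of_real (- (q / \<Delta>)) * (cnj b * \<eta>)" by (simp add: l_def)
  then have "Re l = - (q / \<Delta>) * Re (cnj b * \<eta>)"
    unfolding times_complex.sel Re_complex_of_real Im_complex_of_real by simp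
  ultimately have "Re l = - (q / \<Delta>) * ((q - \<Delta> / q) / 2)"
    by (simp only:)
  also have "\<dots> = (1 - k) / 2"
    using q0 \<Delta> by (simp add: k_def field_simps power2_eq_square)
  finally have l: "Re l = (1 - k) / 2" .
  have k: "k > 0" using q0 \<Delta> by (simp add: k_def)
  show ?thesis
  proof (rule that[OF k l])
    fix t :: complex assume t: "norm t < 1"
    define d where "d = 1 - cnj \<eta> * t"
    have d0: "d \<noteq> 0"
    proof
      assume "d = 0"
      then have "norm (cnj \<eta> * t) = 1" by (simp add: d_def)
      then show False using \<eta> t by (simp add: norm_mult)
    qed
    define D where "D = cnj b * t + cnj a"
    have D0: "D \<noteq> 0" unfolding D_def using disc_aut_denom_nonzero[OF ab, of t] t by simp
    have D: "D = of_real q - cnj b * \<eta> * d"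
    proof -
      have "D = of_real q - cnj b * \<eta> + cnj b * (\<eta> * cnj \<eta>) * t"
        unfolding D_def ca ec by simp
      then show ?thesis by (simp add: d_def algebra_simps)
    qed
    have "1 - cnj \<eta> * disc_aut a b t = (D - cnj \<eta> * (a * t + b)) / D"
      using D0 unfolding disc_aut_def D_def[symmetric] by (simp add: field_simps)
    also have "D - cnj \<eta> * (a * t + b) = d * X + cnj b * t * (1 - \<eta> * cnj \<eta>)"
      unfolding D_def ca by (subst a) (simp add: d_def X_def algebra_simps)
    finally have "1 - cnj \<eta> * disc_aut a b t = d * X / D"
      using ec by simp
    then have "1 / (1 - cnj \<eta> * disc_aut a b t) = D / (d * X)" by simp
    also have "\<dots> = of_real k * (1 / d) + l"
      unfolding D X k_def l_def using q0 \<Delta> d0 by (simp add: field_simps power2_eq_square)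
    finally show "1 / (1 - cnj \<eta> * disc_aut a b t) = of_real k * (1 / (1 - cnj \<eta> * t)) + l"
      unfolding d_def .
  qed
qed

text \<open>With \<open>\<omega> = cnj \<eta>\<close> on the symmetrized bidisc, this function takes the value
  \<open>(1 / (1 - \<omega> z) + 1 / (1 - \<omega> w)) / 2\<close> at \<open>sym_pair z w\<close>: the mean of the two half-plane coordinates with \<open>\<eta>\<close> at infinity.\<close>

lemma mean_has_derivative:
  fixes x :: "complex^2"
  assumes "1 - \<omega> * x $ 1 + \<omega>\<^sup>2 * x $ 2 \<noteq> 0"
  shows "((\<lambda>x :: complex^2. (2 - \<omega> * x $ 1) / (2 * (1 - \<omega> * x $ 1 + \<omega>\<^sup>2 * x $ 2))) has_derivative
    (\<lambda>v. ((- \<omega> * v $ 1) * (2 * (1 - \<omega> * x $ 1 + \<omega>\<^sup>2 * x $ 2))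
         - (2 - \<omega> * x $ 1) * (2 * (\<omega>\<^sup>2 * v $ 2 - \<omega> * v $ 1)))
       / ((2 * (1 - \<omega> * x $ 1 + \<omega>\<^sup>2 * x $ 2)) * (2 * (1 - \<omega> * x $ 1 + \<omega>\<^sup>2 * x $ 2))))) (at x)"
proof (rule has_derivative_divide')
  show "2 * (1 - \<omega> * x $ 1 + \<omega>\<^sup>2 * x $ 2) \<noteq> 0"
    using assms by (metis mult_eq_0_iff zero_neq_numeral)
  have nth: "((\<lambda>x :: complex^2. x $ i) has_derivative (\<lambda>v. v $ i)) (at x)" for i
    by (rule bounded_linear_imp_has_derivative[OF bounded_linear_vec_nth])
  show "((\<lambda>x. 2 - \<omega> * x $ 1) has_derivative (\<lambda>v. - \<omega> * v $ 1)) (at x)"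
    by (auto intro!: derivative_eq_intros nth)
  show "((\<lambda>x. 2 * (1 - \<omega> * x $ 1 + \<omega>\<^sup>2 * x $ 2)) has_derivative
         (\<lambda>v. 2 * (\<omega>\<^sup>2 * v $ 2 - \<omega> * v $ 1))) (at x)"
    by (auto intro!: derivative_eq_intros nth)
qed

text \<open>In the half-plane coordinate \<open>P\<close> with \<open>\<eta>\<close> at infinity, the automorphism is \<open>v \<mapsto> k v + l\<close>.  So the
  mean of the coordinates of \<open>t\<close> and of its image is the affine function \<open>((1 + k) P t + l) / 2\<close> of
  \<open>P t\<close>.  The left inverse takes the mean, undoes the affine map and returns to the disc; the
  mean of two points of a half-plane stays in the half-plane.\<close>

lemma boundary_fixed_point_geodesic:
  assumes ab: "norm b < norm a" and \<eta>: "norm \<eta> = 1" "disc_aut a b \<eta> = \<eta>"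
  shows "geodesic_map (\<lambda>t. sym_pair t (disc_aut a b t))"
proof -
  obtain k :: real and l where k: "k > 0" and l: "Re l = (1 - k) / 2" and
    kl: "\<And>t. norm t < 1 \<Longrightarrow> 1 / (1 - cnj \<eta> * disc_aut a b t) = of_real k * (1 / (1 - cnj \<eta> * t)) + l"
    using disc_aut_affine_at_fixed_point[OF assms] by blast
  have ec: "\<eta> * cnj \<eta> = 1" by (rule unit_cnj[OF \<eta>(1)])
  define \<omega> where "\<omega> = cnj \<eta>"
  have \<omega>: "norm \<omega> = 1" "\<eta> * \<omega> = 1" using \<eta> ec by (auto simp: \<omega>_def)
  define P where "P = (\<lambda>z. 1 / (1 - \<omega> * z))"
  define A where "A = (\<lambda>x :: complex^2. (2 - \<omega> * x $ 1) / (2 * (1 - \<omega> * x $ 1 + \<omega>\<^sup>2 * x $ 2)))"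
  define g where "g = (\<lambda>v. \<eta> * (1 - 1 / ((2 * v - l) / (1 + of_real k))))"
  define H where "H = {v. Re v > 1 / 2}"
  have nz: "1 - \<omega> * z \<noteq> 0" if "norm z < 1" for z
  proof
    assume "1 - \<omega> * z = 0"
    then have "norm (\<omega> * z) = 1" by simp
    then show False using that \<omega> by (simp add: norm_mult)
  qed
  have fac: "1 - \<omega> * (z + w) + \<omega>\<^sup>2 * (z * w) = (1 - \<omega> * z) * (1 - \<omega> * w)" for z w
    by (simp add: algebra_simps power2_eq_square)
  have A: "A (sym_pair z w) = (P z + P w) / 2" if "norm z < 1" "norm w < 1" for z w
    using nz[OF that(1)] nz[OF that(2)] unfolding A_def P_def sym_pair_nth fac
    by (simp add: divide_simps) (simp add: algebra_simps)
  have P: "Re (P z) > 1 / 2" if "norm z < 1" for z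
    unfolding P_def using \<omega> that by (intro half_plane_of_disc) (simp add: norm_mult)
  have holA: "holomorphic_C2 A symmetrized_bidisc"
    unfolding holomorphic_C2_def
  proof
    fix x assume "x \<in> symmetrized_bidisc"
    then obtain z w where x: "x = sym_pair z w" "norm z < 1" "norm w < 1"
      by (rule symmetrized_bidiscE)
    then have n: "1 - \<omega> * x $ 1 + \<omega>\<^sup>2 * x $ 2 \<noteq> 0"
      using fac nz by simp
    note d = mean_has_derivative[OF n]
    show "\<exists>L. Vector_Spaces.linear (*s) (*) L \<and> (A has_derivative L) (at x)"
      unfolding A_def
      by (rule exI, rule conjI[OF _ d], unfold_locales)
         (simp_all add: diff_divide_distrib add_divide_distrib algebra_simps)
  qed
  have AH: "A ` symmetrized_bidisc \<subseteq> H"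
  proof
    fix y assume "y \<in> A ` symmetrized_bidisc"
    then obtain z w where y: "y = (P z + P w) / 2" "norm z < 1" "norm w < 1"
      using A by (metis imageE symmetrized_bidiscE)
    have "Re y = (Re (P z) + Re (P w)) / 2" by (simp add: y(1))
    then show "y \<in> H" using P[OF y(2)] P[OF y(3)] by (simp add: H_def)
  qed
  have k1: "Re ((2 * v - l) / (1 + of_real k)) > 1 / 2" if "v \<in> H" for v
  proof -
    have "(2 * v - l) / (1 + of_real k) = (2 * v - l) / of_real (1 + k)" by simp
    then have "Re ((2 * v - l) / (1 + of_real k)) = (2 * Re v - (1 - k) / 2) / (1 + k)"
      unfolding Re_divide_of_real by (simp add: l Re_divide_of_real)
    moreover have "(1 + k) / 2 < 2 * Re v - (1 - k) / 2"
      using that by (simp add: H_def field_simps)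
    then have "1 / 2 < (2 * Re v - (1 - k) / 2) / (1 + k)"
      using k by (simp only: less_divide_eq) simp
    ultimately show ?thesis by (simp only:)
  qed
  have k10: "1 + complex_of_real k \<noteq> 0"
  proof -
    have "1 + complex_of_real k = of_real (1 + k)" by simp
    then show ?thesis using k by (metis add_pos_pos less_irrefl of_real_eq_0_iff zero_less_one)
  qed
  have holg: "g holomorphic_on H"
  proof -
    have "(2 * v - l) / (1 + of_real k) \<noteq> 0" if "v \<in> H" for v
    proof
      assume "(2 * v - l) / (1 + of_real k) = 0"
      then show False using k1[OF that] by (simp only: zero_complex.sel)
    qed
    then show ?thesis
      unfolding g_def using k10 by (intro holomorphic_intros) auto
  qed
  have "open H" unfolding H_def by (rule open_halfspace_Re_gt)
  define \<Phi> where "\<Phi> = (\<lambda>x. g (A x))"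
  have "holomorphic_C2 \<Phi> symmetrized_bidisc"
    unfolding \<Phi>_def by (rule holomorphic_C2_compose[OF holA AH holg \<open>open H\<close>])
  moreover have "\<Phi> ` symmetrized_bidisc \<subseteq> ball 0 1"
  proof -
    have "norm (g v) < 1" if "v \<in> H" for v
      using disc_of_half_plane[OF k1[OF that]] \<eta>(1) unfolding g_def by (simp add: norm_mult)
    then show ?thesis using AH unfolding \<Phi>_def by fastforce
  qed
  moreover have "\<Phi> (sym_pair t (disc_aut a b t)) = t" if "t \<in> ball 0 1" for t
  proof -
    have t: "norm t < 1" using that by simp
    have "P (disc_aut a b t) = of_real k * P t + l"
      using kl[OF t] unfolding P_def \<omega>_def .
    then have "2 * A (sym_pair t (disc_aut a b t)) - l = P t * (1 + of_real k)"
      unfolding A[OF t disc_aut_norm_less_1[OF ab t]] by (simp add: algebra_simps)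
    then have "(2 * A (sym_pair t (disc_aut a b t)) - l) / (1 + of_real k) = P t"
      using k10 by simp
    then have "\<Phi> (sym_pair t (disc_aut a b t)) = \<eta> * (1 - 1 / P t)"
      unfolding \<Phi>_def g_def by (simp only:)
    also have "\<dots> = t"
      using nz[OF t] \<omega>(2) by (simp add: P_def)
    finally show ?thesis .
  qed
  moreover have "(\<lambda>t. sym_pair t (disc_aut a b t) $ i) holomorphic_on ball 0 1" for i
    using exhaust_2[of i] disc_aut_holomorphic[OF ab] by (auto intro!: holomorphic_intros)
  moreover have "(\<lambda>t. sym_pair t (disc_aut a b t)) ` ball 0 1 \<subseteq> symmetrized_bidisc"
    using disc_aut_norm_less_1[OF ab] by (auto simp: symmetrized_bidisc_iff)
  ultimately show ?thesis
    unfolding geodesic_map_def by blast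
qed

lemma closure_image_disc:
  fixes f :: "complex \<Rightarrow> 'a::t2_space"
  assumes "continuous_on (cball 0 1) f"
  shows "closure (f ` ball 0 1) = f ` cball 0 1"
proof
  have "closed (f ` cball 0 1)"
    using assms by (intro compact_imp_closed compact_continuous_image) auto
  then show "closure (f ` ball 0 1) \<subseteq> f ` cball 0 1"
    by (intro closure_minimal) auto
  have "f ` closure (ball 0 1) \<subseteq> closure (f ` ball 0 1)"
    using assms by (intro image_closure_subset closure_subset) auto
  then show "f ` cball 0 1 \<subseteq> closure (f ` ball 0 1)" by simp
qed

lemma continuous_on_sym_pair:
  assumes "continuous_on S f" "continuous_on S g"
  shows "continuous_on S (\<lambda>t. sym_pair (f t) (g t))"
proof -
  have "(\<lambda>t. sym_pair (f t) (g t)) = (\<lambda>t. \<chi> i. if i = 1 then f t + g t else f t * g t)"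
    by (auto simp: fun_eq_iff vec_eq_iff forall_2)
  moreover have "continuous_on S (\<lambda>t. if i = 1 then f t + g t else f t * g t)" for i :: 2
    using assms by (cases "i = 1") (auto intro!: continuous_intros)
  ultimately show ?thesis
    by (simp only: continuous_on_vec_lambda)
qed

text \<open>Both closures are images of the closed disc, and a pair is royal when its entries agree.  So the
  intersection corresponds to the fixed points of the automorphism in the closed disc.\<close>

lemma graph_meets_royal:
  assumes ab: "norm b < norm a"
  shows "closure ((\<lambda>t. sym_pair t (disc_aut a b t)) ` ball 0 1) \<inter> closure royal_variety
    = (\<lambda>z. sym_pair z z) ` {z. norm z \<le> 1 \<and> disc_aut a b z = z}"
proof -
  have "royal_variety = (\<lambda>z. sym_pair z z) ` ball 0 1"
    by (auto simp: royal_variety_def sym_pair_def power2_eq_square)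
  moreover have "closure ((\<lambda>z. sym_pair z z) ` ball 0 1) = (\<lambda>z. sym_pair z z) ` cball 0 1"
    by (intro closure_image_disc continuous_on_sym_pair continuous_on_id)
  ultimately have R: "closure royal_variety = (\<lambda>z. sym_pair z z) ` cball 0 1"
    by (simp only:)
  have "continuous_on (cball 0 1) (disc_aut a b)"
    by (intro continuous_at_imp_continuous_on ballI DERIV_isCont[OF disc_aut_has_field_derivative[OF ab]])
       simp
  then have D: "closure ((\<lambda>t. sym_pair t (disc_aut a b t)) ` ball 0 1)
      = (\<lambda>t. sym_pair t (disc_aut a b t)) ` cball 0 1"
    by (intro closure_image_disc continuous_on_sym_pair) auto
  show ?thesis unfolding R D by (fastforce simp: sym_pair_eq_iff image_iff)
qed

lemma royal_boundary_iff: "sym_pair z z \<in> royal_boundary \<longleftrightarrow> norm z = 1"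
proof -
  have *: "royal_boundary = {sym_pair z z | z. norm z = 1}"
    by (simp add: royal_boundary_def sym_pair_def power2_eq_square)
  show ?thesis unfolding * by (auto simp: sym_pair_eq_iff)
qed

text \<open>A second parametrization \<open>h'\<close> of the same geodesic factors as \<open>h' = h \<circ> f\<close> with \<open>f = \<Phi> \<circ> h'\<close>, so
  its derivative at the point is a multiple of that of \<open>h\<close>.\<close>

lemma tangent_space_eq:
  assumes h: "geodesic_map h" and t: "norm t < 1"
  shows "tangent_space (h ` ball 0 1) (h t) = vec.span {deriv_C2 h t}"
proof
  show "vec.span {deriv_C2 h t} \<subseteq> tangent_space (h ` ball 0 1) (h t)"
  proof
    fix v assume "v \<in> vec.span {deriv_C2 h t}"
    then obtain c where "v = c *s deriv_C2 h t"
      by (auto simp: vec.span_singleton)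
    moreover have "t \<in> ball 0 1" using t by simp
    ultimately show "v \<in> tangent_space (h ` ball 0 1) (h t)"
      unfolding tangent_space_def using h by blast
  qed
  show "tangent_space (h ` ball 0 1) (h t) \<subseteq> vec.span {deriv_C2 h t}"
  proof
    fix v assume "v \<in> tangent_space (h ` ball 0 1) (h t)"
    then obtain c h' t' where v: "v = c *s deriv_C2 h' t'" and h': "geodesic_map h'"
      and im: "h ` ball 0 1 = h' ` ball 0 1" and t': "t' \<in> ball 0 1" "h' t' = h t"
      unfolding tangent_space_def by blast
    obtain \<Phi> where \<Phi>: "holomorphic_C2 \<Phi> symmetrized_bidisc" "\<forall>z\<in>ball 0 1. \<Phi> (h z) = z"
      using h unfolding geodesic_map_def by blast
    have hol: "\<And>i. (\<lambda>z. h z $ i) holomorphic_on ball 0 1" "\<And>i. (\<lambda>z. h' z $ i) holomorphic_on ball 0 1"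
      using h h' by (simp_all add: geodesic_map_def)
    define f where "f = (\<lambda>z. \<Phi> (h' z))"
    have hf: "h' z = h (f z)" if "z \<in> ball 0 1" for z
    proof -
      have "h' z \<in> h ` ball 0 1" using im that by blast
      then obtain w where "w \<in> ball 0 1" "h' z = h w" by blast
      then show ?thesis using \<Phi>(2) by (simp add: f_def)
    qed
    have ft: "f t' = t" using \<Phi>(2) t t' by (simp add: f_def)
    have "h' t' \<in> symmetrized_bidisc" using h' t' unfolding geodesic_map_def by blast
    then obtain L where L: "Vector_Spaces.linear (*s) (*) L" "(\<Phi> has_derivative L) (at (h' t'))"
      using \<Phi>(1) unfolding holomorphic_C2_def by blast
    define \<kappa> where "\<kappa> = L (deriv_C2 h' t')"
    have f: "(f has_field_derivative \<kappa>) (at t')"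
      unfolding f_def \<kappa>_def
      by (rule holomorphic_C2_along_curve[where h = h' and t = t', OF L])
         (use holomorphic_derivI[OF hol(2)] t' in \<open>auto simp: deriv_C2_def\<close>)
    have "deriv (\<lambda>z. h' z $ i) t' = deriv (\<lambda>z. h z $ i) t * \<kappa>" for i
    proof (rule DERIV_imp_deriv)
      have "((\<lambda>z. h z $ i) has_field_derivative deriv (\<lambda>z. h z $ i) t) (at (f t'))"
        unfolding ft using holomorphic_derivI[OF hol(1)] t by auto
      from DERIV_chain2[OF this f]
      show "((\<lambda>z. h' z $ i) has_field_derivative deriv (\<lambda>z. h z $ i) t * \<kappa>) (at t')"
        by (rule has_field_derivative_transform_within_open[of _ _ _ "ball 0 1"]) (use hf t' in auto)
    qed
    then have "deriv_C2 h' t' = \<kappa> *s deriv_C2 h t"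
      by (simp add: deriv_C2_def vec_eq_iff mult.commute)
    then show "v \<in> vec.span {deriv_C2 h t}"
      unfolding v by (metis vec.span_base vec.span_scale singletonI)
  qed
qed

section \<open>Counting fixed points\<close>

lemma disc_aut_fixed_iff:
  assumes "norm b < norm a" "norm z \<le> 1"
  shows "disc_aut a b z = z \<longleftrightarrow> cnj b * z\<^sup>2 - 2 * \<i> * of_real (Im a) * z - b = 0"
proof -
  have im: "2 * \<i> * of_real (Im a) = a - cnj a"
    by (simp add: complex_eq_iff)
  have "z * (cnj b * z + cnj a) - (a * z + b) = cnj b * z\<^sup>2 - 2 * \<i> * of_real (Im a) * z - b"
    unfolding im by (simp add: algebra_simps power2_eq_square)
  moreover have "disc_aut a b z = z \<longleftrightarrow> z * (cnj b * z + cnj a) - (a * z + b) = 0"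
    using disc_aut_denom_nonzero[OF assms] by (auto simp: disc_aut_def divide_eq_eq)
  ultimately show ?thesis by (simp only:)
qed

text \<open>The fixed points are the roots of the quadratic equation in \<open>disc_aut_fixed_iff\<close>, whose
  discriminant is \<open>4 s\<^sup>2\<close>.  For real \<open>s\<close> both numerators \<open>\<i> Im a \<plusminus> s\<close> have modulus \<open>norm b\<close>, so both
  roots are unimodular.\<close>

lemma boundary_fixed_points:
  assumes ab: "norm b < norm a" and b: "b \<noteq> 0" and s: "s\<^sup>2 = (norm b)\<^sup>2 - (Im a)\<^sup>2"
  shows "{z. norm z \<le> 1 \<and> disc_aut a b z = z}
          = {(\<i> * of_real (Im a) + of_real s) / cnj b, (\<i> * of_real (Im a) - of_real s) / cnj b}"
    and "norm ((\<i> * of_real (Im a) + of_real s) / cnj b) = 1"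
    and "norm ((\<i> * of_real (Im a) - of_real s) / cnj b) = 1"
proof -
  define p q where "p = \<i> * of_real (Im a) + complex_of_real s" and "q = \<i> * of_real (Im a) - complex_of_real s"
  have "(norm p)\<^sup>2 = (norm b)\<^sup>2" "(norm q)\<^sup>2 = (norm b)\<^sup>2"
    using s unfolding cmod_power2[of p] cmod_power2[of q] by (simp_all add: p_def q_def)
  then have "norm p = norm b" "norm q = norm b"
    by (simp_all add: power2_eq_iff_nonneg)
  then have n: "norm (p / cnj b) = 1" "norm (q / cnj b) = 1"
    using b by (simp_all add: norm_divide)
  then show "norm ((\<i> * of_real (Im a) + of_real s) / cnj b) = 1"
    "norm ((\<i> * of_real (Im a) - of_real s) / cnj b) = 1"
    by (simp_all add: p_def q_def)
  have pq: "p + q = 2 * \<i> * of_real (Im a)" "p * q = - (b * cnj b)"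
  proof -
    show "p + q = 2 * \<i> * of_real (Im a)" by (simp add: p_def q_def)
    have "p * q = - of_real ((Im a)\<^sup>2 + s\<^sup>2)"
      by (simp add: p_def q_def algebra_simps power2_eq_square)
    also have "(Im a)\<^sup>2 + s\<^sup>2 = (norm b)\<^sup>2" using s by simp
    finally show "p * q = - (b * cnj b)" by (simp only: complex_norm_square)
  qed
  have "disc_aut a b z = z \<longleftrightarrow> z = p / cnj b \<or> z = q / cnj b" if z: "norm z \<le> 1" for z
  proof -
    have "cnj b * (cnj b * z\<^sup>2 - 2 * \<i> * of_real (Im a) * z - b) = (cnj b * z - p) * (cnj b * z - q)"
      unfolding pq(1)[symmetric] using pq(2) by (simp add: algebra_simps power2_eq_square)
    then have "cnj b * z\<^sup>2 - 2 * \<i> * of_real (Im a) * z - b = 0 \<longleftrightarrow> (cnj b * z - p) * (cnj b * z - q) = 0"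
      using b by (metis complex_cnj_zero_iff mult_eq_0_iff)
    then show ?thesis
      unfolding disc_aut_fixed_iff[OF ab z] using b
      by (simp add: nonzero_eq_divide_eq mult.commute)
  qed
  then show "{z. norm z \<le> 1 \<and> disc_aut a b z = z}
          = {(\<i> * of_real (Im a) + of_real s) / cnj b, (\<i> * of_real (Im a) - of_real s) / cnj b}"
    using n unfolding p_def[symmetric] q_def[symmetric] by (auto intro: eq_refl)
qed

text \<open>The elliptic case.  With \<open>\<beta> = Im a\<close>, the roots of the fixed-point equation are
  \<open>\<i> (\<beta> \<plusminus> sqrt (\<beta>\<^sup>2 - (norm b)\<^sup>2)) / cnj b\<close>, and for \<open>b \<noteq> 0\<close> their product
  has modulus 1.  The sign of \<open>\<sigma>\<close>
  selects the larger root; dividing the product by it gives the smaller one in a form that makes sense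
  for \<open>b = 0\<close> as well.\<close>

lemma interior_fixed_point:
  assumes ab: "norm b < \<bar>Im a\<bar>"
  shows "\<exists>z. norm z < 1 \<and> disc_aut a b z = z"
proof -
  have ba: "norm b < norm a" using ab abs_Im_le_cmod[of a] by simp
  define \<beta> where "\<beta> = Im a"
  define \<sigma> where "\<sigma> = sgn \<beta> * sqrt (\<beta>\<^sup>2 - (norm b)\<^sup>2)"
  have "(norm b)\<^sup>2 < \<beta>\<^sup>2"
    using ab power_strict_mono[of "norm b" "\<bar>\<beta>\<bar>" 2] by (simp add: \<beta>_def)
  moreover have "\<beta> \<noteq> 0" using ab by (auto simp: \<beta>_def)
  ultimately have \<sigma>: "\<sigma>\<^sup>2 = \<beta>\<^sup>2 - (norm b)\<^sup>2"
    by (simp add: \<sigma>_def power_mult_distrib sgn_if)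
  have "\<bar>\<beta> + \<sigma>\<bar> \<ge> \<bar>\<beta>\<bar>"
  proof -
    have "\<bar>\<beta> + sgn \<beta> * s\<bar> \<ge> \<bar>\<beta>\<bar>" if "s \<ge> 0" for s
      using that by (auto simp: sgn_if)
    then show ?thesis using \<open>(norm b)\<^sup>2 < \<beta>\<^sup>2\<close> by (simp add: \<sigma>_def)
  qed
  then have big: "norm b < \<bar>\<beta> + \<sigma>\<bar>" using ab by (simp add: \<beta>_def)
  define d where "d = complex_of_real (\<beta> + \<sigma>)"
  have d0: "d \<noteq> 0" unfolding d_def using big by (metis abs_zero norm_ge_zero not_less of_real_eq_0_iff)
  define z where "z = \<i> * b / d"
  have z: "norm z < 1"
    using big d0 unfolding z_def by (simp add: norm_divide norm_mult d_def del: of_real_add)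
  have "- (b * cnj b) + 2 * of_real \<beta> * d - d\<^sup>2 = of_real (- (norm b)\<^sup>2 + 2 * \<beta> * (\<beta> + \<sigma>) - (\<beta> + \<sigma>)\<^sup>2)"
    unfolding d_def complex_norm_square[symmetric] by simp
  also have "- (norm b)\<^sup>2 + 2 * \<beta> * (\<beta> + \<sigma>) - (\<beta> + \<sigma>)\<^sup>2 = 0"
    using \<sigma> by (simp add: algebra_simps power2_eq_square)
  finally have zero: "- (b * cnj b) + 2 * of_real \<beta> * d - d\<^sup>2 = 0" by simp
  have "cnj b * z\<^sup>2 - 2 * \<i> * of_real \<beta> * z - b = b / d\<^sup>2 * (- (b * cnj b) + 2 * of_real \<beta> * d - d\<^sup>2)"
    unfolding z_def using d0 by (simp add: field_simps power2_eq_square)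
  then show ?thesis
    using zero disc_aut_fixed_iff[OF ba, of z] z unfolding \<beta>_def by auto
qed

text \<open>Automorphisms other than the identity are hyperbolic, parabolic or elliptic, according to the
  sign of the discriminant of the fixed-point equation.\<close>

lemma fixed_point_trichotomy:
  fixes a b
  defines "F \<equiv> {z. norm z \<le> 1 \<and> disc_aut a b z = z}"
  assumes ab: "norm b < norm a" and not_id: "b \<noteq> 0 \<or> Im a \<noteq> 0"
  shows "card F = 2 \<and> F \<subseteq> sphere 0 1 \<longleftrightarrow> \<bar>Im a\<bar> < norm b"
    and "card F = 1 \<and> F \<subseteq> sphere 0 1 \<longleftrightarrow> \<bar>Im a\<bar> = norm b"
proof -
  consider "norm b < \<bar>Im a\<bar>" | "\<bar>Im a\<bar> = norm b" | "\<bar>Im a\<bar> < norm b"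
    by linarith
  then have "(card F = 2 \<and> F \<subseteq> sphere 0 1 \<longleftrightarrow> \<bar>Im a\<bar> < norm b) \<and>
             (card F = 1 \<and> F \<subseteq> sphere 0 1 \<longleftrightarrow> \<bar>Im a\<bar> = norm b)"
  proof cases
    case 1
    then obtain z where "norm z < 1" "disc_aut a b z = z"
      using interior_fixed_point by blast
    then have "z \<in> F" "z \<notin> sphere 0 1" by (auto simp: F_def)
    then show ?thesis using 1 by auto
  next
    case 2
    then have b: "b \<noteq> 0" using not_id by auto
    have "0\<^sup>2 = (norm b)\<^sup>2 - (Im a)\<^sup>2" using 2 by (simp flip: 2)
    note fp = boundary_fixed_points[OF ab b this, folded F_def]
    then show ?thesis using 2 by auto
  next
    case 3
    then have b: "b \<noteq> 0" by auto
    define s where "s = sqrt ((norm b)\<^sup>2 - (Im a)\<^sup>2)"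
    have "(Im a)\<^sup>2 < (norm b)\<^sup>2"
      using power_strict_mono[OF 3, of 2] by simp
    then have s: "s\<^sup>2 = (norm b)\<^sup>2 - (Im a)\<^sup>2" "s \<noteq> 0" by (auto simp: s_def)
    note fp = boundary_fixed_points[OF ab b s(1), folded F_def]
    have "(\<i> * of_real (Im a) + of_real s) / cnj b \<noteq> (\<i> * of_real (Im a) - of_real s) / cnj b"
    proof
      assume "(\<i> * of_real (Im a) + of_real s) / cnj b = (\<i> * of_real (Im a) - of_real s) / cnj b"
      then have "\<i> * of_real (Im a) + complex_of_real s = \<i> * of_real (Im a) - of_real s"
        using b by (simp only: divide_cancel_right complex_cnj_zero_iff) simp
      then show False using s(2) by (simp add: complex_eq_iff)
    qed
    then show ?thesis using fp 3 by auto
  qed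
  then show "card F = 2 \<and> F \<subseteq> sphere 0 1 \<longleftrightarrow> \<bar>Im a\<bar> < norm b"
    "card F = 1 \<and> F \<subseteq> sphere 0 1 \<longleftrightarrow> \<bar>Im a\<bar> = norm b" by auto
qed

section \<open>Directions as a projective line\<close>

text \<open>The velocity at \<open>t = z\<close> of \<open>t \<mapsto> sym_pair t (f t)\<close> when \<open>f z = w\<close> and \<open>f\<close> has derivative
  \<open>\<mu>\<close> at \<open>z\<close>.\<close>

definition velocity :: "complex \<Rightarrow> complex \<Rightarrow> complex \<Rightarrow> complex^2" where
  "velocity z w \<mu> = vector [1, w] + \<mu> *s vector [1, z]"

lemma velocity_nth [simp]: "velocity z w \<mu> $ 1 = 1 + \<mu>" "velocity z w \<mu> $ 2 = w + \<mu> * z"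
  by (simp_all add: velocity_def)

text \<open>The vectors \<open>(1, w)\<close> and \<open>(1, z)\<close> are linearly independent for \<open>z \<noteq> w\<close>, so \<open>\<mu>\<close> is an affine
  coordinate on the projective line.\<close>

lemma velocity_span_inject:
  assumes "z \<noteq> w" "vec.span {velocity z w \<mu>} = vec.span {velocity z w \<nu>}"
  shows "\<mu> = \<nu>"
proof -
  have "velocity z w \<nu> \<in> vec.span {velocity z w \<mu>}"
    unfolding assms(2) by (rule vec.span_base) simp
  then obtain k where k: "velocity z w \<nu> = k *s velocity z w \<mu>"
    by (auto simp: vec.span_singleton)
  have 1: "1 + \<nu> = k * (1 + \<mu>)" and 2: "w + \<nu> * z = k * (w + \<mu> * z)"
    using arg_cong[OF k, of "\<lambda>v. v $ 1"] arg_cong[OF k, of "\<lambda>v. v $ 2"]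
    by (simp_all only: velocity_nth vector_smult_component)
  have "(w - z) * (1 - k) = (w + \<nu> * z - k * (w + \<mu> * z)) - z * (1 + \<nu> - k * (1 + \<mu>))"
    by (simp add: algebra_simps)
  also have "\<dots> = 0" unfolding 1 2 by simp
  finally have "k = 1" using assms(1) by simp
  then show ?thesis using 1 by simp
qed

lemma velocity_nonzero: "z \<noteq> w \<Longrightarrow> velocity z w \<mu> \<noteq> 0"
proof
  assume "z \<noteq> w" "velocity z w \<mu> = 0"
  then have 1: "1 + \<mu> = 0" and 2: "w + \<mu> * z = 0"
    by (metis velocity_nth zero_index)+
  have "w - z = (w + \<mu> * z) - z * (1 + \<mu>)" by (simp add: algebra_simps)
  then show False using 1 2 \<open>z \<noteq> w\<close> by simp
qed

lemma span_singleton_CP1: "v \<noteq> 0 \<Longrightarrow> vec.span {v} \<in> CP1"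
  by (simp add: CP1_def vec.dim_span)

lemma span_in_chart_domain: "v $ i \<noteq> 0 \<Longrightarrow> vec.span {v} \<in> chart_domain i"
  by (auto simp: chart_domain_def intro!: span_singleton_CP1 bexI[of _ v] vec.span_base)

lemma chart_span:
  assumes "v $ i \<noteq> 0"
  shows "chart i j (vec.span {v}) = v $ j / v $ i"
  unfolding chart_def
proof (rule the_equality)
  show "\<exists>u\<in>vec.span {v}. u $ i \<noteq> 0 \<and> v $ j / v $ i = u $ j / u $ i"
    using assms by (intro bexI[of _ v] vec.span_base) auto
  show "u = v $ j / v $ i" if "\<exists>y\<in>vec.span {v}. y $ i \<noteq> 0 \<and> u = y $ j / y $ i" for u
    using that by (auto simp: vec.span_singleton)
qed

text \<open>The higher complex derivatives of a holomorphic extension serve as the higher derivatives of its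
  restriction to the real line.\<close>

lemma C_infinity_on_holomorphic:
  assumes G: "G holomorphic_on S" "open S" and f: "\<And>t. t \<in> T \<Longrightarrow> of_real t \<in> S \<and> f t = G (of_real t)"
  shows "C_infinity_on T f"
proof -
  define F where "F n = (if n = 0 then f else (\<lambda>t. (deriv ^^ n) G (of_real t)))" for n
  have F: "F n t = (deriv ^^ n) G (of_real t)" if "t \<in> T" for n t
    using f[OF that] by (simp add: F_def)
  have "(F n has_vector_derivative F (Suc n) t) (at t within T)" if t: "t \<in> T" for n t
  proof (rule has_vector_derivative_transform[OF t F])
    have "((deriv ^^ n) G has_field_derivative (deriv ^^ Suc n) G (of_real t)) (at (of_real t))"
      using holomorphic_derivI[OF holomorphic_higher_deriv[OF G] G(2)] f[OF t] by auto
    then show "((\<lambda>t. (deriv ^^ n) G (of_real t)) has_vector_derivative F (Suc n) t) (at t within T)"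
      using has_vector_derivative_real_field unfolding F[OF t] by blast
  qed
  then show ?thesis
    unfolding C_infinity_on_def by (intro exI[of _ F]) (auto simp: F_def)
qed

text \<open>The curve parametrizes part of a circle in the affine coordinate \<open>\<mu>\<close>.  Each standard chart is a
  fractional linear function of \<open>\<mu>\<close>, of determinant \<open>\<plusminus> (z - w)\<close>; it is therefore holomorphic with
  nonzero derivative away from its pole, and the two charts have different poles.\<close>

lemma velocity_circle_smooth:
  assumes zw: "z \<noteq> w" and \<rho>: "\<rho> \<noteq> 0" and "\<alpha> < \<beta>"
  shows "smooth_curve_CP1 \<alpha> \<beta> (\<lambda>t. vec.span {velocity z w (\<rho> * exp (2 * \<i> * of_real t))})"
    (is "smooth_curve_CP1 \<alpha> \<beta> ?c")
  unfolding smooth_curve_CP1_def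
proof
  fix t assume t: "t \<in> {\<alpha>..\<beta>}"
  define V where "V = (\<lambda>u i. velocity z w (\<rho> * exp (2 * \<i> * u)) $ i)"
  define V' where "V' = (\<lambda>u i. \<rho> * (exp (2 * \<i> * u) * (2 * \<i>)) * (vector [1, z] :: complex^2) $ i)"
  have V: "((\<lambda>u. V u i) has_field_derivative V' u i) (at u)" for u and i :: 2
    unfolding V_def V'_def velocity_def by (auto intro!: derivative_eq_intros)
  have cont: "continuous_on UNIV (\<lambda>u. V u i)" for i
    by (intro continuous_at_imp_continuous_on ballI DERIV_isCont[OF V])
  \<comment> \<open>The numerator of the derivative of the chart coordinate \<open>V u j / V u i\<close>.\<close>
  have wronskian: "V' u j * V u i - V u j * V' u i \<noteq> 0" if "i \<noteq> j" for i j :: 2 and u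
  proof -
    have "V' u 2 * V u 1 - V u 2 * V' u 1 = \<rho> * (exp (2 * \<i> * u) * (2 * \<i>)) * (z - w)"
      by (simp add: V_def V'_def velocity_def algebra_simps)
    then have "V' u 2 * V u 1 - V u 2 * V' u 1 \<noteq> 0" using \<rho> zw by simp
    then show ?thesis
      using that exhaust_2[of i] exhaust_2[of j] by (auto simp: algebra_simps)
  qed
  obtain i where i: "V (of_real t) i \<noteq> 0"
    using velocity_nonzero[OF zw, of "\<rho> * exp (2 * \<i> * of_real t)"] by (auto simp: vec_eq_iff V_def)
  obtain j where ij: "i \<noteq> j" by (metis exhaust_2 zero_neq_one one_neq_zero)
  define S where "S = {u. V u i \<noteq> 0}"
  define U where "U = (of_real :: real \<Rightarrow> complex) -` S"
  define G where "G = (\<lambda>u. V u j / V u i)"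
  have S: "open S"
    unfolding S_def using cont by (intro open_Collect_neq continuous_on_const)
  then have U: "open U"
    unfolding U_def by (intro open_vimage continuous_intros)
  have tU: "t \<in> U" using i by (simp add: U_def S_def)
  have cG: "(chart i j \<circ> ?c) \<tau> = G (of_real \<tau>)" if "\<tau> \<in> U" for \<tau>
    using that by (simp add: chart_span U_def S_def V_def G_def)
  have G': "(G has_field_derivative (V' u j * V u i - V u j * V' u i) / (V u i * V u i)) (at u)"
    if "u \<in> S" for u
    unfolding G_def using that by (intro DERIV_divide V) (simp add: S_def)
  have "G holomorphic_on S"
    by (rule holomorphic_onI) (use G' in \<open>auto simp: field_differentiable_def intro: has_field_derivative_at_within\<close>)
  then have smooth: "C_infinity_on (U \<inter> {\<alpha>..\<beta>}) (chart i j \<circ> ?c)"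
    by (rule C_infinity_on_holomorphic[OF _ S]) (use cG in \<open>auto simp: U_def\<close>)
  define v where "v = (V' t j * V t i - V t j * V' t i) / (V t i * V t i)"
  have "((\<lambda>\<tau>. G (of_real \<tau>)) has_vector_derivative v) (at t)"
    unfolding v_def by (rule has_vector_derivative_real_field[OF G']) (use i in \<open>simp add: S_def\<close>)
  then have "((chart i j \<circ> ?c) has_vector_derivative v) (at t)"
    by (rule has_vector_derivative_transform_within_open[OF _ U tU]) (simp only: cG)
  then have "vector_derivative (chart i j \<circ> ?c) (at t within {\<alpha>..\<beta>}) = v"
    using t \<open>\<alpha> < \<beta>\<close> by (intro vector_derivative_at_within_ivl) auto
  moreover have "v \<noteq> 0" using wronskian[OF ij, of t] i by (simp add: v_def)
  moreover have "?c ` (U \<inter> {\<alpha>..\<beta>}) \<subseteq> chart_domain i"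
    by (auto simp: U_def S_def V_def intro!: span_in_chart_domain)
  ultimately show "\<exists>U i j. open U \<and> t \<in> U \<and> i \<noteq> j \<and> ?c ` (U \<inter> {\<alpha>..\<beta>}) \<subseteq> chart_domain i \<and>
       C_infinity_on (U \<inter> {\<alpha>..\<beta>}) (chart i j \<circ> ?c) \<and>
       vector_derivative (chart i j \<circ> ?c) (at t within {\<alpha>..\<beta>}) \<noteq> 0"
    using U tU ij smooth by blast
qed

text \<open>The circle is traversed with angular speed 2, so a parameter interval shorter than \<open>pi\<close> gives a
  simple arc.\<close>

lemma velocity_circle_inj:
  assumes zw: "z \<noteq> w" and \<rho>: "\<rho> \<noteq> 0" and \<beta>: "\<beta> < pi / 2"
  shows "inj_on (\<lambda>t. vec.span {velocity z w (\<rho> * exp (2 * \<i> * of_real t))}) {-\<beta>..\<beta>}"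
proof (rule inj_onI)
  fix s t assume st: "s \<in> {-\<beta>..\<beta>}" "t \<in> {-\<beta>..\<beta>}"
    and "vec.span {velocity z w (\<rho> * exp (2 * \<i> * of_real s))}
       = vec.span {velocity z w (\<rho> * exp (2 * \<i> * of_real t))}"
  then have "exp (2 * \<i> * of_real s) = exp (2 * \<i> * of_real t)"
    using velocity_span_inject[OF zw] \<rho> by (metis mult_left_cancel)
  then obtain n :: int where
    "2 * \<i> * of_real s = 2 * \<i> * of_real t + of_real (of_int (2 * n) * pi) * \<i>"
    unfolding exp_eq by blast
  then have n: "s = t + of_int n * pi"
    by (simp add: complex_eq_iff)
  have "\<bar>of_int n * pi\<bar> < pi" using n st \<beta> by auto
  then have "\<bar>real_of_int n\<bar> < 1" by (simp add: abs_mult)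
  then have "n = 0" by linarith
  then show "s = t" using n by simp
qed

section \<open>The arc of balanced directions\<close>

lemma deriv_graph:
  assumes e: "norm e = 1" and z: "norm z < 1" "norm w < 1"
  shows "deriv_C2 (\<lambda>t. sym_pair t (transport z w e t)) z
          = velocity z w (of_real ((1 - (norm w)\<^sup>2) / (1 - (norm z)\<^sup>2)) * e\<^sup>2)"
proof -
  have "((\<lambda>t. sym_pair t (transport z w e t) $ i) has_field_derivative
          (1 *s vector [1, transport z w e z] + (e\<^sup>2 * of_real ((1 - (norm w)\<^sup>2) / (1 - (norm z)\<^sup>2))) *s vector [1, z]) $ i) (at z)" for i
    by (rule sym_pair_curve_derivative[OF DERIV_ident transport_derivative[OF e z]])
  then show ?thesis
    unfolding deriv_C2_def velocity_def transport_apply[OF e z(1)]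
    by (simp add: vec_eq_iff DERIV_imp_deriv mult.commute)
qed

text \<open>A geodesic whose closure meets that of the royal variety only in the boundary avoids the royal
  variety, hence is the symmetrized graph of some \<open>transport z w e\<close>.  For \<open>n > 0\<close>, an automorphism
  whose \<open>n\<close> fixed points in the closed disc all lie on the circle has a boundary fixed point,
  which makes its symmetrized graph a geodesic.\<close>

lemma boundary_directions:
  assumes z: "norm z < 1" "norm w < 1" "z \<noteq> w" and n: "n > 0"
  shows "{M. M \<in> CP1 \<and> (\<exists>D. geodesic D \<and> sym_pair z w \<in> D \<and> tangent_space D (sym_pair z w) = M \<and>
            card (closure D \<inter> closure royal_variety) = n \<and>
            closure D \<inter> closure royal_variety \<subseteq> royal_boundary)}
       = {vec.span {velocity z w (of_real ((1 - (norm w)\<^sup>2) / (1 - (norm z)\<^sup>2)) * e\<^sup>2)} | e.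
            norm e = 1 \<and> card {t. norm t \<le> 1 \<and> transport z w e t = t} = n \<and>
            {t. norm t \<le> 1 \<and> transport z w e t = t} \<subseteq> sphere 0 1}"
    (is "?L = ?R")
proof -
  define D where "D e = (\<lambda>t. sym_pair t (transport z w e t)) ` ball 0 1" for e
  define F where "F e = {t. norm t \<le> 1 \<and> transport z w e t = t}" for e
  define N where "N e = velocity z w (of_real ((1 - (norm w)\<^sup>2) / (1 - (norm z)\<^sup>2)) * e\<^sup>2)" for e
  have meet: "closure (D e) \<inter> closure royal_variety = (\<lambda>z. sym_pair z z) ` F e" if "norm e = 1" for e
    unfolding D_def F_def transport_def
    by (rule graph_meets_royal[OF transport_nondegenerate[OF that z(1,2)]])
  have card_meet: "card (closure (D e) \<inter> closure royal_variety) = card (F e)" if "norm e = 1" for e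
    unfolding meet[OF that] by (rule card_image) (auto simp: inj_on_def sym_pair_eq_iff)
  have meet_boundary: "closure (D e) \<inter> closure royal_variety \<subseteq> royal_boundary \<longleftrightarrow> F e \<subseteq> sphere 0 1"
    if "norm e = 1" for e
    unfolding meet[OF that] by (auto simp: royal_boundary_iff)
  have geod: "geodesic (D e) \<and> sym_pair z w \<in> D e \<and> tangent_space (D e) (sym_pair z w) = vec.span {N e}"
    if e: "norm e = 1" and F: "card (F e) = n" "F e \<subseteq> sphere 0 1" for e
  proof -
    obtain \<eta> where "\<eta> \<in> F e" using F(1) n by (metis card.empty ex_in_conv less_irrefl)
    then have \<eta>: "norm \<eta> = 1" "transport z w e \<eta> = \<eta>" using F(2) by (auto simp: F_def)
    have gm: "geodesic_map (\<lambda>t. sym_pair t (transport z w e t))"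
      using boundary_fixed_point_geodesic[OF transport_nondegenerate[OF e z(1,2)] \<eta>(1)] \<eta>(2)
      unfolding transport_def by blast
    have "sym_pair z w \<in> D e"
      unfolding D_def using transport_apply[OF e z(1)] z(1) by (auto intro!: image_eqI[of _ _ z])
    then show ?thesis
      using tangent_space_eq[OF gm z(1)] gm
      unfolding D_def N_def deriv_graph[OF e z(1,2)] transport_apply[OF e z(1)] geodesic_def by blast
  qed
  show ?thesis
    unfolding F_def[symmetric] N_def[symmetric]
  proof (intro subset_antisym subsetI)
    fix M assume "M \<in> ?L"
    then obtain D' where D': "geodesic D'" "sym_pair z w \<in> D'" "tangent_space D' (sym_pair z w) = M"
      "card (closure D' \<inter> closure royal_variety) = n" "closure D' \<inter> closure royal_variety \<subseteq> royal_boundary"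
      by blast
    have "D' \<inter> royal_variety = {}"
    proof (rule ccontr)
      assume "D' \<inter> royal_variety \<noteq> {}"
      then obtain y where y: "y \<in> D'" "y \<in> royal_variety" by blast
      then have "y \<in> royal_boundary"
        using D'(5) closure_subset[of D'] closure_subset[of royal_variety] by blast
      then obtain u where "y = sym_pair u u" "norm u = 1"
        by (auto simp: royal_boundary_def sym_pair_def power2_eq_square)
      then show False using y(2) by (simp add: royal_variety_iff)
    qed
    then obtain e where e: "norm e = 1" "D' = D e"
      using geodesic_avoiding_royal[OF D'(1) _ D'(2)] unfolding D_def by metis
    have F: "card (F e) = n" "F e \<subseteq> sphere 0 1"
      using D'(4,5) unfolding e(2) card_meet[OF e(1)] meet_boundary[OF e(1)] by auto
    have "M = vec.span {N e}" using geod[OF e(1) F] D'(3) e(2) by simp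
    then show "M \<in> {vec.span {N e} | e. norm e = 1 \<and> card (F e) = n \<and> F e \<subseteq> sphere 0 1}"
      using e F by blast
  next
    fix M assume "M \<in> {vec.span {N e} | e. norm e = 1 \<and> card (F e) = n \<and> F e \<subseteq> sphere 0 1}"
    then obtain e where e: "M = vec.span {N e}" "norm e = 1" and F: "card (F e) = n" "F e \<subseteq> sphere 0 1"
      by blast
    have "M \<in> CP1"
      unfolding e(1) N_def by (rule span_singleton_CP1[OF velocity_nonzero[OF z(3)]])
    then show "M \<in> ?L"
      using geod[OF e(2) F] card_meet[OF e(2)] meet_boundary[OF e(2)] F e(1) by blast
  qed
qed

text \<open>The discriminant of the fixed-point equation, expressed through the trace: \<open>R\<close> is half the trace
  of the matrix and \<open>\<Delta>\<close> its determinant.\<close>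

lemma transport_fixed_points:
  assumes e: "norm e = 1" and z: "norm z < 1" "norm w < 1" "z \<noteq> w"
  defines "F \<equiv> {t. norm t \<le> 1 \<and> transport z w e t = t}" and "R \<equiv> Re (e * (1 - z * cnj w))"
    and "\<Delta> \<equiv> (1 - (norm z)\<^sup>2) * (1 - (norm w)\<^sup>2)"
  shows "card F = 2 \<and> F \<subseteq> sphere 0 1 \<longleftrightarrow> \<Delta> < R\<^sup>2"
    and "card F = 1 \<and> F \<subseteq> sphere 0 1 \<longleftrightarrow> R\<^sup>2 = \<Delta>"
proof -
  define a b where "a = e - cnj e * w * cnj z" and "b = cnj e * w - e * z"
  have m: "transport z w e = disc_aut a b" by (simp add: transport_def a_def b_def)
  have ab: "norm b < norm a" unfolding a_def b_def by (rule transport_nondegenerate[OF e z(1,2)])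
  have "b \<noteq> 0 \<or> Im a \<noteq> 0"
  proof (rule ccontr)
    assume "\<not> ?thesis"
    then have "b = 0" "cnj a = a" by (auto simp: complex_eq_iff)
    moreover have "a \<noteq> 0" using ab by auto
    ultimately have "disc_aut a b z = z" by (simp add: disc_aut_def)
    then show False using transport_apply[OF e z(1), of w] z(3) m by simp
  qed
  note tri = fixed_point_trichotomy[OF ab this]
  have "Re a = R"
    by (simp add: a_def R_def algebra_simps)
  moreover have "(norm a)\<^sup>2 - (norm b)\<^sup>2 = \<Delta>"
    unfolding a_def b_def \<Delta>_def by (rule transport_determinant[OF e])
  ultimately have eq: "R\<^sup>2 - \<Delta> = (norm b)\<^sup>2 - \<bar>Im a\<bar>\<^sup>2"
    by (simp add: cmod_power2[of a])
  have "\<bar>Im a\<bar> < norm b \<longleftrightarrow> \<bar>Im a\<bar>\<^sup>2 < (norm b)\<^sup>2"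
    by (meson abs_ge_zero norm_ge_zero power2_less_imp_less power_strict_mono zero_less_numeral)
  then show "card F = 2 \<and> F \<subseteq> sphere 0 1 \<longleftrightarrow> \<Delta> < R\<^sup>2"
    unfolding F_def m tri using eq by linarith
  have "\<bar>Im a\<bar> = norm b \<longleftrightarrow> \<bar>Im a\<bar>\<^sup>2 = (norm b)\<^sup>2"
    by (metis abs_ge_zero norm_ge_zero power2_eq_imp_eq)
  then show "card F = 1 \<and> F \<subseteq> sphere 0 1 \<longleftrightarrow> R\<^sup>2 = \<Delta>"
    unfolding F_def m tri using eq by linarith
qed

lemma double_exp: "exp (2 * \<i> * of_real t) = (cis t)\<^sup>2"
  by (metis Complex.DeMoivre cis_conv_exp mult.assoc mult.commute of_real_mult of_real_numeral of_nat_numeral)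

text \<open>Only the square of the rotation parameter matters for a direction, so a unit number may be moved
  to the right half-plane by a change of sign.\<close>

lemma unit_up_to_sign:
  assumes "norm u = 1"
  obtains t where "\<bar>t\<bar> \<le> pi / 2" "u\<^sup>2 = (cis t)\<^sup>2" "(Re u)\<^sup>2 = (cos t)\<^sup>2"
proof -
  have "\<exists>t. \<bar>t\<bar> \<le> pi / 2 \<and> v = cis t" if v: "norm v = 1" "Re v \<ge> 0" for v
  proof -
    have n: "(Re v)\<^sup>2 + (Im v)\<^sup>2 = 1" using v(1) by (metis cmod_power2 one_power2)
    have "\<bar>Im v\<bar> \<le> 1" using v(1) abs_Im_le_cmod[of v] by simp
    then have i: "-1 \<le> Im v" "Im v \<le> 1" by auto
    have "cos (arcsin (Im v)) = sqrt (1 - (Im v)\<^sup>2)" using i by (rule cos_arcsin)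
    also have "\<dots> = Re v" using n v(2) by (intro real_sqrt_unique) auto
    finally have "v = cis (arcsin (Im v))" using i by (simp add: complex_eq_iff)
    moreover have "\<bar>arcsin (Im v)\<bar> \<le> pi / 2" using arcsin_bounded[OF i] by auto
    ultimately show ?thesis by blast
  qed
  from this[of u] this[of "- u"] assms
  consider t where "\<bar>t\<bar> \<le> pi / 2" "u = cis t" | t where "\<bar>t\<bar> \<le> pi / 2" "- u = cis t"
    by (metis linear neg_0_le_iff_le norm_minus_cancel uminus_complex.sel(1))
  then show ?thesis
  proof cases
    case (2 t)
    then have "u = - cis t" by (metis minus_minus)
    then show ?thesis using that[of t] 2 by simp
  qed (use that in auto)
qed

lemma cos_compare:
  assumes "\<bar>t\<bar> \<le> pi / 2" "0 < \<delta>" "\<delta> < 1"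
  shows "\<delta>\<^sup>2 < (cos t)\<^sup>2 \<longleftrightarrow> \<bar>t\<bar> < arccos \<delta>" and "(cos t)\<^sup>2 = \<delta>\<^sup>2 \<longleftrightarrow> \<bar>t\<bar> = arccos \<delta>"
proof -
  have d: "-1 \<le> \<delta>" "\<delta> \<le> 1" using assms by auto
  have c: "cos t \<ge> 0" using assms(1) by (intro cos_ge_zero) auto
  have "cos t = cos \<bar>t\<bar>" by (simp add: cos_abs_real)
  moreover have "cos (arccos \<delta>) = \<delta>" using d by simp
  moreover have "0 \<le> arccos \<delta>" "arccos \<delta> \<le> pi" using arccos_bounded[OF d] by auto
  moreover have "\<bar>t\<bar> \<le> pi" using assms(1) pi_gt_zero by linarith
  ultimately have "\<delta> < cos t \<longleftrightarrow> \<bar>t\<bar> < arccos \<delta>" "cos t = \<delta> \<longleftrightarrow> \<bar>t\<bar> = arccos \<delta>"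
    by (metis abs_ge_zero cos_mono_less_eq, metis abs_ge_zero cos_inj_pi)
  moreover have "\<delta>\<^sup>2 < (cos t)\<^sup>2 \<longleftrightarrow> \<delta> < cos t" "(cos t)\<^sup>2 = \<delta>\<^sup>2 \<longleftrightarrow> cos t = \<delta>"
    using c assms(2) by (auto simp: power2_eq_iff_nonneg power_strict_mono intro: power2_less_imp_less)
  ultimately show "\<delta>\<^sup>2 < (cos t)\<^sup>2 \<longleftrightarrow> \<bar>t\<bar> < arccos \<delta>" "(cos t)\<^sup>2 = \<delta>\<^sup>2 \<longleftrightarrow> \<bar>t\<bar> = arccos \<delta>"
    by auto
qed

text \<open>The exceptional and the purely balanced directions come from the parabolic and the hyperbolic
  automorphisms taking \<open>z\<close> to \<open>w\<close>.  The parameter is written as \<open>e = cis t * \<epsilon>\<close>, where \<open>\<epsilon>\<close> is the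
  conjugate phase of \<open>\<kappa> = 1 - z * cnj w\<close>; then half the trace of the matrix is
  \<open>cos t * norm \<kappa>\<close>, and the trace condition becomes a condition on \<open>\<bar>t\<bar>\<close> alone.\<close>

lemma direction_arc:
  assumes z: "norm z < 1" "norm w < 1" "z \<noteq> w"
  obtains \<rho> \<theta> where "\<rho> \<noteq> 0" "0 < \<theta>" "\<theta> < pi / 2"
    "{M. exceptional_direction (sym_pair z w) M}
       = (\<lambda>t. vec.span {velocity z w (\<rho> * exp (2 * \<i> * of_real t))}) ` {t. \<bar>t\<bar> = \<theta>}"
    "{M. purely_balanced_direction (sym_pair z w) M}
       = (\<lambda>t. vec.span {velocity z w (\<rho> * exp (2 * \<i> * of_real t))}) ` {t. \<bar>t\<bar> < \<theta>}"
proof -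
  define \<kappa> where "\<kappa> = 1 - z * cnj w"
  define \<Delta> where "\<Delta> = (1 - (norm z)\<^sup>2) * (1 - (norm w)\<^sup>2)"
  define r where "r = (1 - (norm w)\<^sup>2) / (1 - (norm z)\<^sup>2)"
  have "\<Delta> > 0" "r > 0"
    using z one_minus_norm_square_pos by (auto simp: \<Delta>_def r_def)
  have "complex_of_real ((norm \<kappa>)\<^sup>2) = of_real (\<Delta> + (norm (z - w))\<^sup>2)"
    unfolding \<Delta>_def of_real_add of_real_mult of_real_diff of_real_1 complex_norm_square
    by (simp add: \<kappa>_def algebra_simps)
  then have "(norm \<kappa>)\<^sup>2 = \<Delta> + (norm (z - w))\<^sup>2"
    by (simp only: of_real_eq_iff)
  then have \<Delta>\<kappa>: "\<Delta> < (norm \<kappa>)\<^sup>2" using z(3) by simp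
  then have \<kappa>: "norm \<kappa> > 0" using \<open>\<Delta> > 0\<close> by auto
  define \<delta> where "\<delta> = sqrt \<Delta> / norm \<kappa>"
  have \<delta>2: "\<delta>\<^sup>2 = \<Delta> / (norm \<kappa>)\<^sup>2" using \<open>\<Delta> > 0\<close> by (simp add: \<delta>_def power_divide)
  \<comment> \<open>\<open>\<delta>\<^sup>2\<close> is \<open>1\<close> minus the squared pseudohyperbolic distance of \<open>z\<close> and \<open>w\<close>.\<close>
  have \<delta>: "0 < \<delta>" "\<delta> < 1"
  proof -
    show "0 < \<delta>" using \<open>\<Delta> > 0\<close> \<kappa> by (simp add: \<delta>_def)
    have "\<delta>\<^sup>2 < 1" using \<Delta>\<kappa> \<kappa> unfolding \<delta>2 by simp
    then show "\<delta> < 1" using \<open>0 < \<delta>\<close> by (simp add: power_less_one_iff)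
  qed
  define \<theta> where "\<theta> = arccos \<delta>"
  have \<theta>: "0 < \<theta>" "\<theta> < pi / 2"
    using arccos_lt_bounded[of \<delta>] arccos_less_mono[of \<delta> 0] \<delta> by (auto simp: \<theta>_def)
  define \<epsilon> where "\<epsilon> = cnj \<kappa> / of_real (norm \<kappa>)"
  have \<epsilon>: "norm \<epsilon> = 1" "\<epsilon> * \<kappa> = of_real (norm \<kappa>)" "\<epsilon> \<noteq> 0"
    using \<kappa> complex_norm_square[of \<kappa>] by (auto simp: \<epsilon>_def norm_divide field_simps power2_eq_square)
  define \<rho> where "\<rho> = of_real r * \<epsilon>\<^sup>2"
  have \<rho>: "\<rho> \<noteq> 0" using \<epsilon>(3) \<open>r > 0\<close> by (simp add: \<rho>_def)
  define N where "N = (\<lambda>t. vec.span {velocity z w (\<rho> * exp (2 * \<i> * of_real t))})"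
  have N: "N t = vec.span {velocity z w (of_real r * (cis t * \<epsilon>)\<^sup>2)}" for t
    unfolding N_def \<rho>_def double_exp by (simp add: power_mult_distrib mult_ac)
  have Re: "(Re (cis t * \<epsilon> * \<kappa>))\<^sup>2 = (norm \<kappa>)\<^sup>2 * (cos t)\<^sup>2" for t
    unfolding mult.assoc \<epsilon>(2) by (simp add: power_mult_distrib)
  have param: "{vec.span {velocity z w (of_real r * e\<^sup>2)} | e. norm e = 1 \<and> Q ((Re (e * \<kappa>))\<^sup>2)} = N ` T"
    if Q: "\<And>t. \<bar>t\<bar> \<le> pi / 2 \<Longrightarrow> Q ((norm \<kappa>)\<^sup>2 * (cos t)\<^sup>2) \<longleftrightarrow> t \<in> T" 
      and T: "\<And>t. t \<in> T \<Longrightarrow> \<bar>t\<bar> \<le> pi / 2" for Q T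
  proof (intro subset_antisym subsetI)
    fix M assume "M \<in> {vec.span {velocity z w (of_real r * e\<^sup>2)} | e. norm e = 1 \<and> Q ((Re (e * \<kappa>))\<^sup>2)}"
    then obtain e where e: "M = vec.span {velocity z w (of_real r * e\<^sup>2)}" "norm e = 1" "Q ((Re (e * \<kappa>))\<^sup>2)"
      by blast
    have "norm (e / \<epsilon>) = 1" using e(2) \<epsilon>(1) by (simp add: norm_divide)
    then obtain t where t: "\<bar>t\<bar> \<le> pi / 2" "(e / \<epsilon>)\<^sup>2 = (cis t)\<^sup>2" "(Re (e / \<epsilon>))\<^sup>2 = (cos t)\<^sup>2"
      by (rule unit_up_to_sign)
    have "e * \<kappa> = of_real (norm \<kappa>) * (e / \<epsilon>)"
      using \<epsilon>(3) unfolding \<epsilon>(2)[symmetric] by simp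
    then have "Re (e * \<kappa>) = norm \<kappa> * Re (e / \<epsilon>)"
      by (simp only: times_complex.sel Re_complex_of_real Im_complex_of_real mult_zero_left diff_zero)
    then have "(Re (e * \<kappa>))\<^sup>2 = (norm \<kappa>)\<^sup>2 * (cos t)\<^sup>2"
      using t(3) by (simp only: power_mult_distrib)
    then have "t \<in> T" using Q[OF t(1)] e(3) by simp
    moreover have "e\<^sup>2 = (cis t * \<epsilon>)\<^sup>2"
      using t(2) \<epsilon>(3) by (simp add: power_mult_distrib power_divide field_simps)
    then have "M = N t" unfolding e(1) N by simp
    ultimately show "M \<in> N ` T" by blast
  next
    fix M assume "M \<in> N ` T"
    then obtain t where t: "M = N t" "t \<in> T" by blast
    have "norm (cis t * \<epsilon>) = 1" using \<epsilon>(1) by (simp add: norm_mult)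
    moreover have "Q ((Re (cis t * \<epsilon> * \<kappa>))\<^sup>2)" unfolding Re using Q[OF T] t(2) by blast
    ultimately show "M \<in> {vec.span {velocity z w (of_real r * e\<^sup>2)} | e. norm e = 1 \<and> Q ((Re (e * \<kappa>))\<^sup>2)}"
      unfolding t(1) N by blast
  qed
  have threshold: "\<Delta> < (norm \<kappa>)\<^sup>2 * X \<longleftrightarrow> \<delta>\<^sup>2 < X" "(norm \<kappa>)\<^sup>2 * X = \<Delta> \<longleftrightarrow> X = \<delta>\<^sup>2" for X
    unfolding \<delta>2 using \<kappa> by (auto simp: field_simps)
  have by_count: "{M. M \<in> CP1 \<and> (\<exists>D. geodesic D \<and> sym_pair z w \<in> D \<and> tangent_space D (sym_pair z w) = M \<and>
            card (closure D \<inter> closure royal_variety) = n \<and>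
            closure D \<inter> closure royal_variety \<subseteq> royal_boundary)}
      = {vec.span {velocity z w (of_real r * e\<^sup>2)} | e. norm e = 1 \<and> Q e}"
    if Q: "\<And>e. norm e = 1 \<Longrightarrow> card {t. norm t \<le> 1 \<and> transport z w e t = t} = n \<and>
            {t. norm t \<le> 1 \<and> transport z w e t = t} \<subseteq> sphere 0 1 \<longleftrightarrow> Q e" and "n > 0" for n Q
    unfolding boundary_directions[OF z \<open>n > 0\<close>] r_def
    by (intro Collect_cong ex_cong1) (use Q in blast)
  have "{M. exceptional_direction (sym_pair z w) M}
      = {vec.span {velocity z w (of_real r * e\<^sup>2)} | e. norm e = 1 \<and> (Re (e * \<kappa>))\<^sup>2 = \<Delta>}"
  proof (rule trans[OF _ by_count[of 1]])
    show "card {t. norm t \<le> 1 \<and> transport z w e t = t} = 1 \<and>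
        {t. norm t \<le> 1 \<and> transport z w e t = t} \<subseteq> sphere 0 1 \<longleftrightarrow> (Re (e * \<kappa>))\<^sup>2 = \<Delta>"
      if "norm e = 1" for e
      unfolding \<kappa>_def \<Delta>_def by (rule transport_fixed_points(2)[OF that z])
  qed (auto simp: exceptional_direction_def exceptional_def)
  also have "\<dots> = N ` {t. \<bar>t\<bar> = \<theta>}"
    using cos_compare(2)[OF _ \<delta>] \<theta> by (intro param) (auto simp: threshold \<theta>_def)
  finally have ex: "{M. exceptional_direction (sym_pair z w) M} = N ` {t. \<bar>t\<bar> = \<theta>}" .
  have "{M. purely_balanced_direction (sym_pair z w) M}
      = {vec.span {velocity z w (of_real r * e\<^sup>2)} | e. norm e = 1 \<and> \<Delta> < (Re (e * \<kappa>))\<^sup>2}"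
  proof (rule trans[OF _ by_count[of 2]])
    show "card {t. norm t \<le> 1 \<and> transport z w e t = t} = 2 \<and>
        {t. norm t \<le> 1 \<and> transport z w e t = t} \<subseteq> sphere 0 1 \<longleftrightarrow> \<Delta> < (Re (e * \<kappa>))\<^sup>2"
      if "norm e = 1" for e
      unfolding \<kappa>_def \<Delta>_def by (rule transport_fixed_points(1)[OF that z])
  qed (auto simp: purely_balanced_direction_def purely_balanced_def)
  also have "\<dots> = N ` {t. \<bar>t\<bar> < \<theta>}"
    using cos_compare(1)[OF _ \<delta>] \<theta> by (intro param) (auto simp: threshold \<theta>_def)
  finally have pb: "{M. purely_balanced_direction (sym_pair z w) M} = N ` {t. \<bar>t\<bar> < \<theta>}" .
  show ?thesis
    using that[OF \<rho> \<theta> ex[unfolded N_def] pb[unfolded N_def]] .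
qed

theorem corollary4p24:
  fixes x :: "complex^2"
  shows "(x \<in> royal_variety \<longrightarrow>
            (\<nexists>M. purely_balanced_direction x M \<or> exceptional_direction x M)) \<and>
         (x \<in> symmetrized_bidisc - royal_variety \<longrightarrow>
            card {M. exceptional_direction x M} = 2 \<and>
            (\<exists>a b c. a < b \<and> smooth_curve_CP1 a b c \<and> inj_on c {a..b} \<and>
               {c a, c b} = {M. exceptional_direction x M} \<and>
               c ` {a<..<b} = {M. purely_balanced_direction x M}))"
proof (intro conjI impI)
  assume x: "x \<in> royal_variety"
  \<comment> \<open>The point \<open>x\<close> itself would lie in the intersection of the closures.\<close>
  have "x \<notin> royal_boundary"
    using x by (auto simp: royal_boundary_def royal_variety_def vec_eq_iff forall_2)
  moreover have "x \<in> closure D \<inter> closure royal_variety" if "x \<in> D" for D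
    using x that closure_subset by blast
  ultimately show "\<nexists>M. purely_balanced_direction x M \<or> exceptional_direction x M"
    unfolding purely_balanced_direction_def exceptional_direction_def purely_balanced_def exceptional_def
    by blast
next
  assume x: "x \<in> symmetrized_bidisc - royal_variety"
  then obtain z w where zw: "x = sym_pair z w" "norm z < 1" "norm w < 1"
    by (auto elim: symmetrized_bidiscE)
  then have "z \<noteq> w" using x by (auto simp: royal_variety_iff)
  obtain \<rho> \<theta> where \<rho>: "\<rho> \<noteq> 0" and \<theta>: "0 < \<theta>" "\<theta> < pi / 2"
    and ex: "{M. exceptional_direction x M}
       = (\<lambda>t. vec.span {velocity z w (\<rho> * exp (2 * \<i> * of_real t))}) ` {t. \<bar>t\<bar> = \<theta>}"
    and pb: "{M. purely_balanced_direction x M}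
       = (\<lambda>t. vec.span {velocity z w (\<rho> * exp (2 * \<i> * of_real t))}) ` {t. \<bar>t\<bar> < \<theta>}"
    using direction_arc[OF zw(2,3) \<open>z \<noteq> w\<close>] unfolding zw(1) by metis
  define c where "c = (\<lambda>t. vec.span {velocity z w (\<rho> * exp (2 * \<i> * of_real t))})"
  have smooth: "smooth_curve_CP1 (- \<theta>) \<theta> c"
    unfolding c_def using velocity_circle_smooth[OF \<open>z \<noteq> w\<close> \<rho>] \<theta> by simp
  have inj: "inj_on c {- \<theta>..\<theta>}"
    unfolding c_def by (rule velocity_circle_inj[OF \<open>z \<noteq> w\<close> \<rho> \<theta>(2)])
  have ends: "{t. \<bar>t\<bar> = \<theta>} = {- \<theta>, \<theta>}" "{t. \<bar>t\<bar> < \<theta>} = {- \<theta><..<\<theta>}"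
    using \<theta>(1) by auto
  have ex': "{c (- \<theta>), c \<theta>} = {M. exceptional_direction x M}"
    unfolding ex ends c_def by simp
  have "c (- \<theta>) \<noteq> c \<theta>"
    using inj_onD[OF inj, of "- \<theta>" \<theta>] \<theta>(1) by auto
  then show "card {M. exceptional_direction x M} = 2"
    unfolding ex'[symmetric] by simp
  have "c ` {- \<theta><..<\<theta>} = {M. purely_balanced_direction x M}"
    unfolding pb ends c_def ..
  then show "\<exists>a b c. a < b \<and> smooth_curve_CP1 a b c \<and> inj_on c {a..b} \<and>
               {c a, c b} = {M. exceptional_direction x M} \<and>
               c ` {a<..<b} = {M. purely_balanced_direction x M}"
    using smooth inj ex' \<theta>(1) by (intro exI[of _ "- \<theta>"] exI[of _ \<theta>] exI[of _ c]) auto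
qed

end
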